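(* Suppose $f\colon\mathbf C\to\mathbf D$ is one of the following functors between graph categories (inclusions and orientation-forgetting functors): $\mathbf\Omega\to\mathbf U_{\mathrm{cyc}}$, $\mathbf\Omega\to\mathbf G_{\mathrm{sc}}$, $\mathbf U_{\mathrm{cyc}}\to\mathbf U_0$, $\mathbf G_{\mathrm{sc}}\to(\mathbf U_0)_{/\mathfrak o}$, $(\mathbf U_0)_{/\mathfrak o}\to\mathbf U_0$, $\mathbf G_{\mathrm{sc}}\to\mathbf G$, $(\mathbf U_0)_{/\mathfrak o}\to\mathbf U_{/\mathfrak o}$, $\mathbf U_0\to\mathbf U$, $\mathbf G\to\mathbf U_{/\mathfrak o}$, $\mathbf U_{/\mathfrak o}\to\mathbf U$, $\mathbf U_{/\mathfrak o}\to\widetilde{\mathbf U}_{/\mathfrak o}$, $\mathbf U\to\widetilde{\mathbf U}$, $\widetilde{\mathbf U}_{/\mathfrak o}\to\widetilde{\mathbf U}$. If $M\in\widehat{\mathbf D}$ is Segal, then so is $f^*M\in\widehat{\mathbf C}$. If $f$ is one of the functors $\mathbf\Omega\to\mathbf U_{\mathrm{cyc}}$, $\mathbf G_{\mathrm{sc}}\to\mathbf U_0$, $\mathbf U_{/\mathfrak o}\to\mathbf U$, $\widetilde{\mathbf U}_{/\mathfrak o}\to\widetilde{\mathbf U}$, and if $M\in\widehat{\mathbf D}$ is a presheaf such that $f^*M\in\widehat{\mathbf C}$ is Segal, then $M$ is Segal.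
   Context: $\widehat{\mathbf C}=\mathrm{Fun}(\mathbf C^{\mathrm{op}},\mathbf{Set})$ and $f^*$ is restriction along $f$. **Graphs.** A graph $G$ consists of finite sets $A_G$ (arcs) and $V_G$ (vertices), a fixpoint-free involution $a\mapsto a^\dagger$ on $A_G$, a subset $D_G\subseteq A_G$, and a function $t\colon D_G\to V_G$. For $v\in V_G$, $\mathrm{nb}(v)=t^{-1}(v)$; the boundary is $\partial(G)=A_G\setminus D_G$; edges are $\dagger$-orbits $[a,a^\dagger]$, and an edge is internal if $a,a^\dagger\in D_G$. Connected means non-empty and not a disjoint union of two non-empty graphs. The edge graph $\updownarrow$ has two arcs interchanged by $\dagger$ and $D=V=\varnothing$; the $n$-star $\star_n$ ($n\ge0$) has one vertex, $D=\{1,\dots,n\}$, $A=\{1,1^\dagger,\dots,n,n^\dagger\}$. A tree is a connected graph that is simply connected (contains no cycles); equivalently, a connected graph with $V_G=\varnothing$, or with exactly $|V_G|-1$ internal edges. An étale map $f\colon H\to G$ consists of functions on $A$, $D$, $V$ compatible with all structure, restricting to bijections $\mathrm{nb}(v)\to\mathrm{nb}(f(v))$. An embedding is an étale map between connected graphs, injective on vertices. $\mathrm{Emb}(G)$ is the set of classes $[f]$ of embeddings with codomain $G$ ($f\sim h$ iff $f=hz$, $z$ an isomorphism); $[f\colon H\to G]$ is an edge if $H\cong\updownarrow$; $\varsigma[f]=f(V_H)$, $\partial([f])=f(\partial(H))$. For $v\in V_G$, $\iota_v\colon\star_v\to G$ is the canonical embedding, with $\star_v$ having vertex set $\{v\}$,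 $D_{\star_v}=\mathrm{nb}(v)$, arc set $\mathrm{nb}(v)\amalg\{b_d\}_{d\in\mathrm{nb}(v)}$, $d^\dagger=b_d$, $\iota_v(d)=d$, $\iota_v(b_d)=d^\dagger$. A nodeless loop is an additional kind of connected graph $K$, with two arcs, $D_K=V_K=\varnothing$, and $\partial(K)=\varnothing$ by definition. The only embeddings with domain $K$ are isomorphisms of nodeless loops; $\mathrm{Emb}(K)=\{[\updownarrow],[\mathrm{id}_K]\}$ with $\partial([\updownarrow])=A_K$, $\partial([\mathrm{id}_K])=\varnothing$. **$\mathbf U$ and $\widetilde{\mathbf U}$.** $\mathbf U$ has as objects connected graphs (not nodeless loops); a morphism $\varphi\colon G\to G'$ is a pair of an involutive function $\varphi_0\colon A_G\to A_{G'}$ and a function $\varphi_1\colon V_G\to\mathrm{Emb}(G')$ such that: (a) the sets $\varsigma(\varphi_1(v))$ are pairwise disjoint; (b) for each $v$, $a\mapsto\varphi_0(a^\dagger)$ gives a bijection $\mathrm{nb}(v)\to\partial(\varphi_1(v))$; (c) if $\partial(G)=\varnothing$, there is $v$ with $\varphi_1(v)$ not an edge. $\widetilde{\mathbf U}$ has in addition the nodeless loops as objects, and (c) is replaced by: if $\partial(G)=\varnothing$ and every $\varphi_1(v)$ is an edge, then $G'$ is a nodeless loop. In both, the composite of $\varphi\colon G\to G'$ and $\psi\colon G'\to G''$ has $(\psi\varphi)_0=\psi_0\varphi_0$, and $(\psi\varphi)_1(v)$ is the unique class in $\mathrm{Emb}(G'')$ with boundary $\psi_0(\partial(\varphi_1(v)))$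 and vertex set $\coprod_{w\in\varsigma(\varphi_1(v))}\varsigma(\psi_1(w))$. An embedding $f\colon H\to G$ is regarded as the graphical map given by $f$ on arcs and $v\mapsto[\iota_{f(v)}]$; these are the inert maps. A graphical map is active if $\varphi_0$ restricts to a bijection $\partial(G)\to\partial(G')$. Every graphical map factors as $g\circ\alpha$ with $\alpha$ active and $g$ inert, uniquely up to unique isomorphism; write $\mathrm{im}(\varphi)=[g]\in\mathrm{Emb}(G')$. **Other categories.** $\mathbf U_0\subset\mathbf U$ is the full subcategory on trees, $\mathbf U_{\mathrm{cyc}}\subset\mathbf U_0$ that on trees with non-empty boundary. For $\mathbf D\in\{\mathbf U_0,\mathbf U,\widetilde{\mathbf U}\}$, $\mathbf D_{/\mathfrak o}$ has objects pairs $(G,x)$, $G\in\mathbf D$ and $x\colon A_G\to\{+1,-1\}$ with $x(a^\dagger)=-x(a)$; morphisms $(G,x)\to(G',x')$ are the graphical maps with $x'\varphi_0=x$. In $(G,x)$ put $\mathrm{in}(v)=\{d\in\mathrm{nb}(v):x_d=-1\}$, $\mathrm{out}(v)=\{d\in\mathrm{nb}(v):x_d=+1\}$. A directed path is a sequence $e_0v_1e_1\cdots v_ne_n$ ($n\ge0$) of edges and vertices where $e_{i-1}$ contains an arc of $\mathrm{in}(v_i)$ and $e_i$ contains an arc of $\mathrm{out}(v_i)$; $(G,x)\in\mathbf U_{/\mathfrak o}$ is acyclic if no directed path with $n\ge1$ has $e_0=e_n$. For $(G,x)$ acyclic, an embedding $h\colon H\to G$ is a convex inclusion if it is injective on vertices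 and edges and every directed path of $(G,x)$ whose first and last edges lie in the image of $h$ has all its vertices and edges in the image of $h$. $\mathbf G$ (the properadic graphical category) is the subcategory of $\mathbf U_{/\mathfrak o}$ with objects the acyclic $(G,x)$ and morphisms those $\varphi\colon G\to G'$ for which $\mathrm{im}(\varphi)$ is represented by a convex inclusion. $\mathbf G_{\mathrm{sc}}$ is the full subcategory of $\mathbf G$ (equivalently of $\mathbf U_{/\mathfrak o}$) on the $(G,x)$ with $G$ a tree. $\mathbf\Omega$ (the dendroidal category) is the full subcategory of $\mathbf G_{\mathrm{sc}}$ on the directed trees in which $\mathrm{out}(v)$ is a singleton for every vertex $v$. In each category a map is inert if its underlying graphical map is inert. **Segal presheaves.** For any of these categories $\mathbf C$, an object is elementary if its underlying undirected graph is isomorphic to $\updownarrow$ or to some $\star_n$ (nodeless loops are not elementary). $\mathbf C^{\mathrm{el}}_{/c}$ is the category of inert maps $w\to c$ in $\mathbf C$ with $w$ elementary, and (inert) maps over $c$. $Z\in\widehat{\mathbf C}$ is Segal if for every $c\in\mathbf C$ the canonical map $Z_c\to\lim_{(w\to c)\in(\mathbf C^{\mathrm{el}}_{/c})^{\mathrm{op}}}Z_w$ is a bijection. *)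

theory Defs
  imports Main "HOL-Library.FuncSet" "HOL-Library.Infinite_Typeclass"
begin

section \<open>Graphs\<close>

text \<open>
  Nodeless loops carry the same data as the edge graph and differ from it only in their boundary;
  the flag \<open>nodeless\<close> tells the two apart. All functions belonging to graphs, to maps of graphs
  and to graphical maps are extensional (undefined outside their domain), so that equality of such
  data is the intended one.
\<close>

record ('a, 'v) graph =
  arcs :: "'a set"
  verts :: "'v set"
  dag :: "'a \<Rightarrow> 'a"
  darcs :: "'a set"
  tgt :: "'a \<Rightarrow> 'v"
  nodeless :: bool

definition graph_data :: "('a, 'v) graph \<Rightarrow> bool" where
  "graph_data G \<longleftrightarrow>
     finite (arcs G) \<and> finite (verts G) \<and>
     dag G \<in> arcs G \<rightarrow>\<^sub>E arcs G \<and>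
     (\<forall>a\<in>arcs G. dag G (dag G a) = a \<and> dag G a \<noteq> a) \<and>
     darcs G \<subseteq> arcs G \<and>
     tgt G \<in> darcs G \<rightarrow>\<^sub>E verts G"

definition is_graph :: "('a, 'v) graph \<Rightarrow> bool" where
  "is_graph G \<longleftrightarrow> graph_data G \<and> \<not> nodeless G"

definition is_nodeless_loop :: "('a, 'v) graph \<Rightarrow> bool" where
  "is_nodeless_loop G \<longleftrightarrow>
     graph_data G \<and> nodeless G \<and> card (arcs G) = 2 \<and> darcs G = {} \<and> verts G = {}"

definition nb :: "('a, 'v) graph \<Rightarrow> 'v \<Rightarrow> 'a set" where
  "nb G v = {d \<in> darcs G. tgt G d = v}"

definition boundary :: "('a, 'v) graph \<Rightarrow> 'a set" where
  "boundary G = (if nodeless G then {} else arcs G - darcs G)"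

definition edge_of :: "('a, 'v) graph \<Rightarrow> 'a \<Rightarrow> 'a set" where
  "edge_of G a = {a, dag G a}"

definition edges :: "('a, 'v) graph \<Rightarrow> 'a set set" where
  "edges G = edge_of G ` arcs G"

definition subgraph_data :: "('a, 'v) graph \<Rightarrow> 'a set \<Rightarrow> 'v set \<Rightarrow> bool" where
  "subgraph_data G A V \<longleftrightarrow>
     A \<subseteq> arcs G \<and> V \<subseteq> verts G \<and> dag G ` A \<subseteq> A \<and> tgt G ` (darcs G \<inter> A) \<subseteq> V"

definition connected_graph :: "('a, 'v) graph \<Rightarrow> bool" where
  "connected_graph G \<longleftrightarrow>
     (arcs G \<noteq> {} \<or> verts G \<noteq> {}) \<and>
     \<not> (\<exists>A A' V V'. subgraph_data G A V \<and> subgraph_data G A' V' \<and>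
          A \<union> A' = arcs G \<and> A \<inter> A' = {} \<and> V \<union> V' = verts G \<and> V \<inter> V' = {} \<and>
          (A \<noteq> {} \<or> V \<noteq> {}) \<and> (A' \<noteq> {} \<or> V' \<noteq> {}))"

definition conn_graphs :: "('a, 'v) graph set" where
  "conn_graphs = {G. is_graph G \<and> connected_graph G}"

definition nodeless_loops :: "('a, 'v) graph set" where
  "nodeless_loops = {G. is_nodeless_loop G}"

text \<open>
  The arc \<open>as ! i\<close> lies on the \<open>i\<close>-th edge of the cycle: it points to the \<open>i\<close>-th vertex, while its
  partner points to the next vertex. Loops (length 1) and double edges (length 2) are cycles.
\<close>

definition is_cycle :: "('a, 'v) graph \<Rightarrow> 'a list \<Rightarrow> bool" where
  "is_cycle G as \<longleftrightarrow>
     as \<noteq> [] \<and>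
     (\<forall>i < length as. as ! i \<in> darcs G \<and> dag G (as ! i) \<in> darcs G \<and>
        tgt G (dag G (as ! i)) = tgt G (as ! (Suc i mod length as))) \<and>
     distinct (map (tgt G) as) \<and> distinct (map (edge_of G) as)"

definition is_tree :: "('a, 'v) graph \<Rightarrow> bool" where
  "is_tree G \<longleftrightarrow> is_graph G \<and> connected_graph G \<and> \<not> (\<exists>as. is_cycle G as)"

definition edge_graph :: "(bool, unit) graph" where
  "edge_graph =
     \<lparr>arcs = UNIV, verts = {}, dag = Not, darcs = {}, tgt = (\<lambda>_. undefined), nodeless = False\<rparr>"

text \<open>In the star, \<open>(i, True)\<close> is the arc \<open>i\<close> and \<open>(i, False)\<close> its partner.\<close>

definition star_graph :: "nat \<Rightarrow> (nat \<times> bool, unit) graph" where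
  "star_graph n =
     \<lparr>arcs = {1..n} \<times> UNIV, verts = {()},
      dag = restrict (\<lambda>(i, b). (i, \<not> b)) ({1..n} \<times> UNIV),
      darcs = {1..n} \<times> {True}, tgt = restrict (\<lambda>_. ()) ({1..n} \<times> {True}), nodeless = False\<rparr>"


section \<open>Etale maps and embeddings\<close>

type_synonym ('a, 'v, 'b, 'w) gr_map = "('a \<Rightarrow> 'b) \<times> ('v \<Rightarrow> 'w)"

definition etale :: "('a, 'v) graph \<Rightarrow> ('b, 'w) graph \<Rightarrow> ('a, 'v, 'b, 'w) gr_map \<Rightarrow> bool" where
  "etale H G f \<longleftrightarrow>
     fst f \<in> arcs H \<rightarrow>\<^sub>E arcs G \<and> snd f \<in> verts H \<rightarrow>\<^sub>E verts G \<and>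
     (\<forall>a\<in>arcs H. fst f (dag H a) = dag G (fst f a)) \<and>
     (\<forall>d\<in>darcs H. fst f d \<in> darcs G \<and> tgt G (fst f d) = snd f (tgt H d)) \<and>
     (\<forall>v\<in>verts H. bij_betw (fst f) (nb H v) (nb G (snd f v)))"

definition etale_comp ::
  "('a, 'v) graph \<Rightarrow> ('b, 'w, 'c, 'u) gr_map \<Rightarrow> ('a, 'v, 'b, 'w) gr_map \<Rightarrow> ('a, 'v, 'c, 'u) gr_map"
where
  "etale_comp H g f = (compose (arcs H) (fst g) (fst f), compose (verts H) (snd g) (snd f))"

definition etale_id :: "('a, 'v) graph \<Rightarrow> ('a, 'v, 'a, 'v) gr_map" where
  "etale_id G = (restrict id (arcs G), restrict id (verts G))"

definition graph_iso :: "('a, 'v) graph \<Rightarrow> ('b, 'w) graph \<Rightarrow> ('a, 'v, 'b, 'w) gr_map \<Rightarrow> bool" where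
  "graph_iso H G z \<longleftrightarrow>
     etale H G z \<and> bij_betw (fst z) (arcs H) (arcs G) \<and> bij_betw (snd z) (verts H) (verts G) \<and>
     (nodeless H \<longleftrightarrow> nodeless G)"

definition isomorphic :: "('a, 'v) graph \<Rightarrow> ('b, 'w) graph \<Rightarrow> bool" where
  "isomorphic H G \<longleftrightarrow> (\<exists>z. graph_iso H G z)"

definition elementary :: "('a, 'v) graph \<Rightarrow> bool" where
  "elementary G \<longleftrightarrow>
     graph_data G \<and> (isomorphic G edge_graph \<or> (\<exists>n. isomorphic G (star_graph n)))"

text \<open>
  The last condition makes isomorphisms of nodeless loops the only embeddings with domain a
  nodeless loop: etale maps between nodeless loops are automatically bijective. The embeddings
  into a nodeless loop from a graph are the bijections from edges.
\<close>

definition embedding :: "('a, 'v) graph \<Rightarrow> ('b, 'w) graph \<Rightarrow> ('a, 'v, 'b, 'w) gr_map \<Rightarrow> bool" where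
  "embedding H G f \<longleftrightarrow>
     H \<in> conn_graphs \<union> nodeless_loops \<and> G \<in> conn_graphs \<union> nodeless_loops \<and>
     etale H G f \<and> inj_on (snd f) (verts H) \<and> (nodeless H \<longrightarrow> nodeless G)"

text \<open>
  An element of \<open>Emb G\<close> is a class of pairs consisting of a domain, with arcs and vertices in the
  same types as those of \<open>G\<close>, and an embedding. A representative \<open>f\<close> of a class may also have its
  domain in other types.
\<close>

type_synonym ('a, 'v) emb_cls = "(('a, 'v) graph \<times> ('a, 'v, 'a, 'v) gr_map) set"

definition emb_class ::
  "('a, 'v) graph \<Rightarrow> ('b, 'w) graph \<Rightarrow> ('b, 'w, 'a, 'v) gr_map \<Rightarrow> ('a, 'v) emb_cls" where
  "emb_class G H f =
     {(H', f'). embedding H' G f' \<and> (\<exists>z. graph_iso H' H z \<and> f' = etale_comp H' f z)}"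

definition Emb :: "('a, 'v) graph \<Rightarrow> ('a, 'v) emb_cls set" where
  "Emb G = {emb_class G H f | (H :: ('a, 'v) graph) f. embedding H G f}"

text \<open>The vertex set and the boundary of a class do not depend on the representative.\<close>

definition emb_verts :: "('a, 'v) emb_cls \<Rightarrow> 'v set" where
  "emb_verts c = (\<Union>(H, f)\<in>c. snd f ` verts H)"

definition emb_boundary :: "('a, 'v) emb_cls \<Rightarrow> 'a set" where
  "emb_boundary c = (\<Union>(H, f)\<in>c. fst f ` boundary H)"

definition emb_is_edge :: "('a, 'v) emb_cls \<Rightarrow> bool" where
  "emb_is_edge c \<longleftrightarrow> (\<exists>(H, f)\<in>c. isomorphic H edge_graph)"

text \<open>In \<open>star_at G v\<close>, the arc \<open>Inl d\<close> is \<open>d \<in> nb G v\<close> and \<open>Inr d\<close> is its formal partner.\<close>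

definition star_at :: "('a, 'v) graph \<Rightarrow> 'v \<Rightarrow> ('a + 'a, 'v) graph" where
  "star_at G v =
     \<lparr>arcs = Inl ` nb G v \<union> Inr ` nb G v, verts = {v},
      dag = restrict (case_sum Inr Inl) (Inl ` nb G v \<union> Inr ` nb G v),
      darcs = Inl ` nb G v, tgt = restrict (\<lambda>_. v) (Inl ` nb G v), nodeless = False\<rparr>"

definition iota :: "('a, 'v) graph \<Rightarrow> 'v \<Rightarrow> ('a + 'a, 'v, 'a, 'v) gr_map" where
  "iota G v =
     (restrict (case_sum (\<lambda>d. d) (dag G)) (arcs (star_at G v)),
      restrict (\<lambda>w. w) (verts (star_at G v)))"

definition iota_class :: "('a, 'v) graph \<Rightarrow> 'v \<Rightarrow> ('a, 'v) emb_cls" where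
  "iota_class G v = emb_class G (star_at G v) (iota G v)"


section \<open>Graphical maps\<close>

type_synonym ('a, 'v) gmap = "('a \<Rightarrow> 'a) \<times> ('v \<Rightarrow> ('a, 'v) emb_cls)"

definition pre_graphical :: "('a, 'v) graph \<Rightarrow> ('a, 'v) graph \<Rightarrow> ('a, 'v) gmap \<Rightarrow> bool" where
  "pre_graphical G G' \<phi> \<longleftrightarrow>
     fst \<phi> \<in> arcs G \<rightarrow>\<^sub>E arcs G' \<and> (\<forall>a\<in>arcs G. fst \<phi> (dag G a) = dag G' (fst \<phi> a)) \<and>
     snd \<phi> \<in> verts G \<rightarrow>\<^sub>E Emb G' \<and>
     (\<forall>v\<in>verts G. \<forall>w\<in>verts G. v \<noteq> w \<longrightarrow> emb_verts (snd \<phi> v) \<inter> emb_verts (snd \<phi> w) = {}) \<and>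
     (\<forall>v\<in>verts G. bij_betw (\<lambda>a. fst \<phi> (dag G a)) (nb G v) (emb_boundary (snd \<phi> v)))"

definition hom_U :: "('a, 'v) graph \<Rightarrow> ('a, 'v) graph \<Rightarrow> ('a, 'v) gmap set" where
  "hom_U G G' =
     {\<phi>. pre_graphical G G' \<phi> \<and>
         (boundary G = {} \<longrightarrow> (\<exists>v\<in>verts G. \<not> emb_is_edge (snd \<phi> v)))}"

definition hom_Ut :: "('a, 'v) graph \<Rightarrow> ('a, 'v) graph \<Rightarrow> ('a, 'v) gmap set" where
  "hom_Ut G G' =
     {\<phi>. pre_graphical G G' \<phi> \<and>
         (boundary G = {} \<and> (\<forall>v\<in>verts G. emb_is_edge (snd \<phi> v)) \<longrightarrow> is_nodeless_loop G')}"

definition gcomp ::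
  "('a, 'v) graph \<Rightarrow> ('a, 'v) graph \<Rightarrow> ('a, 'v) gmap \<Rightarrow> ('a, 'v) gmap \<Rightarrow> ('a, 'v) gmap" where
  "gcomp G G'' \<psi> \<phi> =
     (compose (arcs G) (fst \<psi>) (fst \<phi>),
      \<lambda>v\<in>verts G. THE c. c \<in> Emb G'' \<and>
         emb_boundary c = fst \<psi> ` emb_boundary (snd \<phi> v) \<and>
         emb_verts c = (\<Union>w\<in>emb_verts (snd \<phi> v). emb_verts (snd \<psi> w)))"

definition gmap_of :: "('a, 'v) graph \<Rightarrow> ('a, 'v) graph \<Rightarrow> ('a, 'v, 'a, 'v) gr_map \<Rightarrow> ('a, 'v) gmap" where
  "gmap_of H G f = (fst f, \<lambda>v\<in>verts H. iota_class G (snd f v))"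

definition gid :: "('a, 'v) graph \<Rightarrow> ('a, 'v) gmap" where
  "gid G = gmap_of G G (etale_id G)"

definition inert :: "('a, 'v) graph \<Rightarrow> ('a, 'v) graph \<Rightarrow> ('a, 'v) gmap \<Rightarrow> bool" where
  "inert G G' \<phi> \<longleftrightarrow> (\<exists>f. embedding G G' f \<and> \<phi> = gmap_of G G' f)"

definition active :: "('a, 'v) graph \<Rightarrow> ('a, 'v) graph \<Rightarrow> ('a, 'v) gmap \<Rightarrow> bool" where
  "active G G' \<phi> \<longleftrightarrow> bij_betw (fst \<phi>) (boundary G) (boundary G')"

text \<open>
  \<open>has_image G G' \<phi> c\<close> says that \<open>c\<close> is the class of the inert part in an active-inert
  factorisation of the morphism \<open>\<phi>\<close> of \<open>U\<close>; there is exactly one such class.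
\<close>

definition has_image ::
  "('a, 'v) graph \<Rightarrow> ('a, 'v) graph \<Rightarrow> ('a, 'v) gmap \<Rightarrow> ('a, 'v) emb_cls \<Rightarrow> bool" where
  "has_image G G' \<phi> c \<longleftrightarrow>
     (\<exists>H \<alpha> g. H \<in> conn_graphs \<and> \<alpha> \<in> hom_U G H \<and> active G H \<alpha> \<and> embedding H G' g \<and>
        \<phi> = gcomp G G' (gmap_of H G' g) \<alpha> \<and> c = emb_class G' H g)"


section \<open>Orientations\<close>

type_synonym ('a, 'v) ograph = "('a, 'v) graph \<times> ('a \<Rightarrow> int)"

definition orientation :: "('a, 'v) graph \<Rightarrow> ('a \<Rightarrow> int) \<Rightarrow> bool" where
  "orientation G x \<longleftrightarrow> x \<in> arcs G \<rightarrow>\<^sub>E {1, -1} \<and> (\<forall>a\<in>arcs G. x (dag G a) = - x a)"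

definition in_arcs :: "('a, 'v) ograph \<Rightarrow> 'v \<Rightarrow> 'a set" where
  "in_arcs c v = {d \<in> nb (fst c) v. snd c d = -1}"

definition out_arcs :: "('a, 'v) ograph \<Rightarrow> 'v \<Rightarrow> 'a set" where
  "out_arcs c v = {d \<in> nb (fst c) v. snd c d = 1}"

text \<open>
  The lists \<open>es\<close> and \<open>vs\<close> are \<open>e\<^sub>0, \<dots>, e\<^sub>n\<close> and \<open>v\<^sub>1, \<dots>, v\<^sub>n\<close>; thus
  \<open>vs ! i\<close> is \<open>v\<close> with index \<open>i + 1\<close>.
\<close>

definition directed_path :: "('a, 'v) ograph \<Rightarrow> 'a set list \<Rightarrow> 'v list \<Rightarrow> bool" where
  "directed_path c es vs \<longleftrightarrow>
     length es = Suc (length vs) \<and> set es \<subseteq> edges (fst c) \<and> set vs \<subseteq> verts (fst c) \<and>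
     (\<forall>i < length vs. es ! i \<inter> in_arcs c (vs ! i) \<noteq> {} \<and> es ! Suc i \<inter> out_arcs c (vs ! i) \<noteq> {})"

definition acyclic_ograph :: "('a, 'v) ograph \<Rightarrow> bool" where
  "acyclic_ograph c \<longleftrightarrow> \<not> (\<exists>es vs. directed_path c es vs \<and> vs \<noteq> [] \<and> hd es = last es)"

definition convex_inclusion :: "('a, 'v) graph \<Rightarrow> ('a, 'v) ograph \<Rightarrow> ('a, 'v, 'a, 'v) gr_map \<Rightarrow> bool" where
  "convex_inclusion H c h \<longleftrightarrow>
     embedding H (fst c) h \<and> inj_on (snd h) (verts H) \<and> inj_on (\<lambda>e. fst h ` e) (edges H) \<and>
     (\<forall>es vs. directed_path c es vs \<and>
        hd es \<in> (\<lambda>e. fst h ` e) ` edges H \<and> last es \<in> (\<lambda>e. fst h ` e) ` edges H \<longrightarrow>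
        set es \<subseteq> (\<lambda>e. fst h ` e) ` edges H \<and> set vs \<subseteq> snd h ` verts H)"


section \<open>Graph categories\<close>

text \<open>
  In \<open>Hom C c d\<close> only objects \<open>c\<close>, \<open>d\<close> of \<open>C\<close> are relevant. The composite
  \<open>Comp C c d e g f\<close> is that of \<open>f : c \<rightarrow> d\<close> and \<open>g : d \<rightarrow> e\<close>.
  A graph category comes with a functor to the category of undirected connected graphs and nodeless
  loops, which is \<open>und\<close> on objects and the identity on (representations of) morphisms.
\<close>

record ('c, 'm) category =
  Ob :: "'c set"
  Hom :: "'c \<Rightarrow> 'c \<Rightarrow> 'm set"
  Id :: "'c \<Rightarrow> 'm"
  Comp :: "'c \<Rightarrow> 'c \<Rightarrow> 'c \<Rightarrow> 'm \<Rightarrow> 'm \<Rightarrow> 'm"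

record ('c, 'a, 'v) graph_category = "('c, ('a, 'v) gmap) category" +
  und :: "'c \<Rightarrow> ('a, 'v) graph"

type_synonym ('a, 'v) ugcat = "(('a, 'v) graph, 'a, 'v) graph_category"
type_synonym ('a, 'v) ogcat = "(('a, 'v) ograph, 'a, 'v) graph_category"

definition full_subcat ::
  "('c, 'a, 'v) graph_category \<Rightarrow> ('c \<Rightarrow> bool) \<Rightarrow> ('c, 'a, 'v) graph_category" where
  "full_subcat C P = C\<lparr>Ob := {c \<in> Ob C. P c}\<rparr>"

definition cat_U :: "('a, 'v) ugcat" where
  "cat_U = \<lparr>Ob = conn_graphs, Hom = hom_U, Id = gid, Comp = (\<lambda>G G' G''. gcomp G G''), und = id\<rparr>"

definition cat_Ut :: "('a, 'v) ugcat" where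
  "cat_Ut = \<lparr>Ob = conn_graphs \<union> nodeless_loops, Hom = hom_Ut, Id = gid,
     Comp = (\<lambda>G G' G''. gcomp G G''), und = id\<rparr>"

definition cat_U0 :: "('a, 'v) ugcat" where
  "cat_U0 = full_subcat cat_U is_tree"

definition cat_Ucyc :: "('a, 'v) ugcat" where
  "cat_Ucyc = full_subcat cat_U0 (\<lambda>G. boundary G \<noteq> {})"

definition over_o :: "('a, 'v) ugcat \<Rightarrow> ('a, 'v) ogcat" where
  "over_o D =
     \<lparr>Ob = {c. fst c \<in> Ob D \<and> orientation (fst c) (snd c)},
      Hom = (\<lambda>c d. {\<phi> \<in> Hom D (fst c) (fst d). \<forall>a\<in>arcs (fst c). snd d (fst \<phi> a) = snd c a}),
      Id = (\<lambda>c. Id D (fst c)),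
      Comp = (\<lambda>c d e. Comp D (fst c) (fst d) (fst e)),
      und = fst\<rparr>"

definition cat_G :: "('a, 'v) ogcat" where
  "cat_G =
     (over_o cat_U)
       \<lparr>Ob := {c \<in> Ob (over_o cat_U). acyclic_ograph c},
        Hom := (\<lambda>c d. {\<phi> \<in> Hom (over_o cat_U) c d.
           \<exists>k. has_image (fst c) (fst d) \<phi> k \<and> (\<exists>(H, h)\<in>k. convex_inclusion H d h)})\<rparr>"

definition cat_Gsc :: "('a, 'v) ogcat" where
  "cat_Gsc = full_subcat cat_G (\<lambda>c. is_tree (fst c))"

definition cat_Omega :: "('a, 'v) ogcat" where
  "cat_Omega = full_subcat cat_Gsc (\<lambda>c. \<forall>v\<in>verts (fst c). is_singleton (out_arcs c v))"


section \<open>Presheaves\<close>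

record ('c, 'm, 'd, 'n) catfun =
  on_ob :: "'c \<Rightarrow> 'd"
  on_mor :: "'m \<Rightarrow> 'n"

definition incl :: "('c, 'm, 'c, 'm) catfun" where
  "incl = \<lparr>on_ob = (\<lambda>c. c), on_mor = (\<lambda>\<phi>. \<phi>)\<rparr>"

definition forget_o :: "(('a, 'v) ograph, ('a, 'v) gmap, ('a, 'v) graph, ('a, 'v) gmap) catfun" where
  "forget_o = \<lparr>on_ob = fst, on_mor = (\<lambda>\<phi>. \<phi>)\<rparr>"

text \<open>\<open>act Z c d \<phi>\<close> is the map \<open>sec Z d \<rightarrow> sec Z c\<close> induced by \<open>\<phi> : c \<rightarrow> d\<close>.\<close>

record ('c, 'm, 'x) psh =
  sec :: "'c \<Rightarrow> 'x set"
  act :: "'c \<Rightarrow> 'c \<Rightarrow> 'm \<Rightarrow> 'x \<Rightarrow> 'x"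

definition presheaf :: "('c, 'm, 'z) category_scheme \<Rightarrow> ('c, 'm, 'x) psh \<Rightarrow> bool" where
  "presheaf C Z \<longleftrightarrow>
     (\<forall>c\<in>Ob C. \<forall>d\<in>Ob C. \<forall>\<phi>\<in>Hom C c d. act Z c d \<phi> \<in> sec Z d \<rightarrow> sec Z c) \<and>
     (\<forall>c\<in>Ob C. \<forall>x\<in>sec Z c. act Z c c (Id C c) x = x) \<and>
     (\<forall>c\<in>Ob C. \<forall>d\<in>Ob C. \<forall>e\<in>Ob C. \<forall>\<phi>\<in>Hom C c d. \<forall>\<psi>\<in>Hom C d e. \<forall>x\<in>sec Z e.
        act Z c e (Comp C c d e \<psi> \<phi>) x = act Z c d \<phi> (act Z d e \<psi> x))"

definition pullback :: "('c, 'm, 'd, 'n) catfun \<Rightarrow> ('d, 'n, 'x) psh \<Rightarrow> ('c, 'm, 'x) psh" where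
  "pullback f Z =
     \<lparr>sec = (\<lambda>c. sec Z (on_ob f c)),
      act = (\<lambda>c d \<phi>. act Z (on_ob f c) (on_ob f d) (on_mor f \<phi>))\<rparr>"

text \<open>The limit of a presheaf over the opposite of \<open>J\<close>, as the set of compatible families.\<close>

definition psh_lim :: "('c, 'm, 'z) category_scheme \<Rightarrow> ('c, 'm, 'x) psh \<Rightarrow> ('c \<Rightarrow> 'x) set" where
  "psh_lim J Z =
     {s \<in> Pi\<^sub>E (Ob J) (sec Z). \<forall>i\<in>Ob J. \<forall>j\<in>Ob J. \<forall>u\<in>Hom J i j. act Z i j u (s j) = s i}"

definition el_slice ::
  "('c, 'a, 'v) graph_category \<Rightarrow> 'c \<Rightarrow> ('c \<times> ('a, 'v) gmap, ('a, 'v) gmap) category" where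
  "el_slice C c =
     \<lparr>Ob = {(w, p). w \<in> Ob C \<and> elementary (und C w) \<and> p \<in> Hom C w c \<and> inert (und C w) (und C c) p},
      Hom = (\<lambda>(w, p) (w', p'). {u \<in> Hom C w w'. inert (und C w) (und C w') u \<and> Comp C w w' c p' u = p}),
      Id = (\<lambda>(w, p). Id C w),
      Comp = (\<lambda>(w, p) (w', p') (w'', p''). Comp C w w' w'')\<rparr>"

definition el_dom :: "('c \<times> ('a, 'v) gmap, ('a, 'v) gmap, 'c, ('a, 'v) gmap) catfun" where
  "el_dom = \<lparr>on_ob = fst, on_mor = (\<lambda>u. u)\<rparr>"

definition segal_map ::
  "('c, 'a, 'v) graph_category \<Rightarrow> ('c, ('a, 'v) gmap, 'x) psh \<Rightarrow> 'c \<Rightarrow> 'x \<Rightarrow> ('c \<times> ('a, 'v) gmap \<Rightarrow> 'x)"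
where
  "segal_map C Z c x = (\<lambda>(w, p)\<in>Ob (el_slice C c). act Z w c p x)"

definition segal :: "('c, 'a, 'v) graph_category \<Rightarrow> ('c, ('a, 'v) gmap, 'x) psh \<Rightarrow> bool" where
  "segal C Z \<longleftrightarrow>
     presheaf C Z \<and>
     (\<forall>c\<in>Ob C. bij_betw (segal_map C Z c) (sec Z c) (psh_lim (el_slice C c) (pullback el_dom Z)))"

end

theory Submission
  imports Defs
begin

text \<open>
  Each of the functors \<open>f\<close> is compatible with elementary objects: every inert map from an elementary
  object to \<open>f c\<close> lifts uniquely along \<open>f\<close>, so the indexing categories of the two Segal limits at
  \<open>c\<close> and \<open>f c\<close> are isomorphic and the Segal condition for \<open>f\<^sup>*M\<close> at \<open>c\<close> is that for \<open>M\<close> at \<open>f c\<close>.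
  Orientations are pulled back along inert maps; for \<open>cat_G\<close> one needs that an elementary graph
  embedded in an acyclic one is convex, since a directed path leaving the star at a vertex and
  returning to it would close up to a directed cycle. For the converse it remains that the functors
  in question are surjective on objects: any graph can be oriented, any orientation of a tree is
  acyclic, and a tree with a boundary arc can be oriented towards that arc.
\<close>

section \<open>Comparison of Segal conditions\<close>

text \<open>All the functors leave morphisms untouched and at most drop an orientation from an
  object. So \<open>slice_comparison\<close> can ask for literal equality of the sets of slice
  morphisms, and for a bijection on slice objects that keeps the map \<open>p\<close>; the
  isomorphism of indexing categories becomes plain reindexing of families. The delicate case is
  \<open>cat_G\<close>: a morphism there must possess an active-inert factorisation with convex
  inert part. For an embedded elementary graph the identity serves as active part. But composites
  are definite descriptions, so even composing with the identity has to be evaluated, and this rests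
  on the fact that a class with the vertex and the boundary of an embedded star is the class of that
  star. The facts about trees share one device: an infinite walk in a finite graph that turns back
  at most at its initial vertex closes up to a cycle. The exception at the initial vertex is what
  allows leaves to be found away from a prescribed root.\<close>

definition slice_comparison ::
  "('c \<Rightarrow> 'd) \<Rightarrow> ('c, 'a, 'v) graph_category \<Rightarrow> ('d, 'a, 'v) graph_category \<Rightarrow> bool" where
  "slice_comparison F C D \<longleftrightarrow>
     (\<forall>c\<in>Ob C. F c \<in> Ob D \<and> und D (F c) = und C c \<and> Id D (F c) = Id C c) \<and>
     (\<forall>c\<in>Ob C. \<forall>d\<in>Ob C. Hom C c d \<subseteq> Hom D (F c) (F d)) \<and>
     (\<forall>c\<in>Ob C. \<forall>d\<in>Ob C. \<forall>e\<in>Ob C. Comp D (F c) (F d) (F e) = Comp C c d e) \<and>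
     (\<forall>c\<in>Ob C. bij_betw (map_prod F id) (Ob (el_slice C c)) (Ob (el_slice D (F c)))) \<and>
     (\<forall>c\<in>Ob C. \<forall>i\<in>Ob (el_slice C c). \<forall>j\<in>Ob (el_slice C c).
        Hom (el_slice D (F c)) (map_prod F id i) (map_prod F id j) = Hom (el_slice C c) i j)"

lemma Ob_el_slice:
  "(w, p) \<in> Ob (el_slice C c) \<longleftrightarrow>
     w \<in> Ob C \<and> elementary (und C w) \<and> p \<in> Hom C w c \<and> inert (und C w) (und C c) p"
  by (simp add: el_slice_def)

lemma Hom_el_slice:
  "u \<in> Hom (el_slice C c) (w, p) (w', p') \<longleftrightarrow>
     u \<in> Hom C w w' \<and> inert (und C w) (und C w') u \<and> Comp C w w' c p' u = p"
  by (simp add: el_slice_def)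

text \<open>Injectivity of \<open>F\<close> is asked only for objects carrying the same map
  \<open>p\<close> to \<open>c\<close>: forgetting an orientation is not injective, but the
  orientation of \<open>w\<close> can be read off from \<open>p\<close>. Elementarity in the last
  premise is what makes slice morphisms lift to \<open>cat_G\<close>.\<close>

lemma slice_comparisonI:
  assumes ob: "\<And>c. c \<in> Ob C \<Longrightarrow> F c \<in> Ob D \<and> und D (F c) = und C c \<and> Id D (F c) = Id C c"
    and hom: "\<And>c d. c \<in> Ob C \<Longrightarrow> d \<in> Ob C \<Longrightarrow> Hom C c d \<subseteq> Hom D (F c) (F d)"
    and comp: "\<And>c d e. c \<in> Ob C \<Longrightarrow> d \<in> Ob C \<Longrightarrow> e \<in> Ob C \<Longrightarrow>
                 Comp D (F c) (F d) (F e) = Comp C c d e"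
    and ob_lift: "\<And>c w p. c \<in> Ob C \<Longrightarrow> w \<in> Ob D \<Longrightarrow> elementary (und D w) \<Longrightarrow> p \<in> Hom D w (F c) \<Longrightarrow>
                 inert (und D w) (und C c) p \<Longrightarrow> \<exists>w'\<in>Ob C. F w' = w \<and> p \<in> Hom C w' c"
    and ob_unique: "\<And>c w w' p. c \<in> Ob C \<Longrightarrow> w \<in> Ob C \<Longrightarrow> w' \<in> Ob C \<Longrightarrow> F w = F w' \<Longrightarrow>
                 p \<in> Hom C w c \<Longrightarrow> p \<in> Hom C w' c \<Longrightarrow> w = w'"
    and hom_lift: "\<And>c w w' p p' u. c \<in> Ob C \<Longrightarrow> w \<in> Ob C \<Longrightarrow> w' \<in> Ob C \<Longrightarrow> p \<in> Hom C w c \<Longrightarrow>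
                 p' \<in> Hom C w' c \<Longrightarrow> elementary (und C w) \<Longrightarrow> u \<in> Hom D (F w) (F w') \<Longrightarrow>
                 inert (und C w) (und C w') u \<Longrightarrow> Comp C w w' c p' u = p \<Longrightarrow> u \<in> Hom C w w'"
  shows "slice_comparison F C D"
  unfolding slice_comparison_def
proof (intro conjI ballI)
  fix c assume c: "c \<in> Ob C"
  show "F c \<in> Ob D" "und D (F c) = und C c" "Id D (F c) = Id C c"
    using ob[OF c] by auto
  show "bij_betw (map_prod F id) (Ob (el_slice C c)) (Ob (el_slice D (F c)))"
    unfolding bij_betw_def
  proof
    show "inj_on (map_prod F id) (Ob (el_slice C c))"
      using ob_unique[OF c] by (auto simp: inj_on_def Ob_el_slice)
    show "map_prod F id ` Ob (el_slice C c) = Ob (el_slice D (F c))" (is "?L = ?R")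
    proof (intro subset_antisym subsetI)
      fix i assume "i \<in> ?L"
      then obtain w p where "i = (F w, p)" "w \<in> Ob C" "elementary (und C w)" "p \<in> Hom C w c"
        "inert (und C w) (und C c) p" by (force simp: Ob_el_slice)
      then show "i \<in> ?R" using ob hom[of w c] c by (auto simp: Ob_el_slice)
    next
      fix i assume i: "i \<in> ?R"
      obtain w p where [simp]: "i = (w, p)" by (cases i)
      from i have *: "w \<in> Ob D" "elementary (und D w)" "p \<in> Hom D w (F c)"
        "inert (und D w) (und C c) p" using ob[OF c] by (auto simp: Ob_el_slice)
      obtain w' where w': "w' \<in> Ob C" "F w' = w" "p \<in> Hom C w' c"
        using ob_lift[OF c *] by blast
      have "(w', p) \<in> Ob (el_slice C c)"
        using w' * ob[OF w'(1)] by (auto simp: Ob_el_slice)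
      then show "i \<in> ?L" using w'(2) by force
    qed
  qed
  fix i j assume i: "i \<in> Ob (el_slice C c)" and j: "j \<in> Ob (el_slice C c)"
  obtain w p where [simp]: "i = (w, p)" by (cases i)
  obtain w' p' where [simp]: "j = (w', p')" by (cases j)
  have w: "w \<in> Ob C" "elementary (und C w)" "p \<in> Hom C w c" using i by (auto simp: Ob_el_slice)
  have w': "w' \<in> Ob C" "p' \<in> Hom C w' c" using j by (auto simp: Ob_el_slice)
  show "Hom (el_slice D (F c)) (map_prod F id i) (map_prod F id j) = Hom (el_slice C c) i j"
    using ob[OF w(1)] ob[OF w'(1)] hom[OF w(1) w'(1)] comp[OF w(1) w'(1) c]
      hom_lift[OF c w(1) w'(1) w(3) w'(2) w(2)]
    by (auto simp: Hom_el_slice)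
qed (use hom comp in auto)

lemma slice_comparison_comp:
  assumes F: "slice_comparison F C D" and G: "slice_comparison G D E"
  shows "slice_comparison (\<lambda>c. G (F c)) C E"
proof -
  have eq: "map_prod (\<lambda>c. G (F c)) id = map_prod G id \<circ> map_prod F id"
    by (auto simp: fun_eq_iff)
  have ob: "F c \<in> Ob D" if "c \<in> Ob C" for c
    using F that by (auto simp: slice_comparison_def)
  have bij: "bij_betw (map_prod F id) (Ob (el_slice C c)) (Ob (el_slice D (F c)))" if "c \<in> Ob C" for c
    using F that by (auto simp: slice_comparison_def)
  have hom: "Hom (el_slice E (G (F c))) (map_prod (\<lambda>c. G (F c)) id i) (map_prod (\<lambda>c. G (F c)) id j) =
      Hom (el_slice C c) i j"
    if c: "c \<in> Ob C" and i: "i \<in> Ob (el_slice C c)" and j: "j \<in> Ob (el_slice C c)" for c i j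
  proof -
    have "map_prod F id i \<in> Ob (el_slice D (F c))" "map_prod F id j \<in> Ob (el_slice D (F c))"
      using bij_betwE[OF bij[OF c]] i j by auto
    then have "Hom (el_slice E (G (F c))) (map_prod G id (map_prod F id i)) (map_prod G id (map_prod F id j))
        = Hom (el_slice D (F c)) (map_prod F id i) (map_prod F id j)"
      using G ob[OF c] unfolding slice_comparison_def by blast
    also have "\<dots> = Hom (el_slice C c) i j"
      using F c i j unfolding slice_comparison_def by blast
    finally show ?thesis by (simp add: eq)
  qed
  have bij': "bij_betw (map_prod (\<lambda>c. G (F c)) id) (Ob (el_slice C c)) (Ob (el_slice E (G (F c))))"
    if "c \<in> Ob C" for c
    unfolding eq using bij_betw_trans[OF bij[OF that]] G ob[OF that]
    unfolding slice_comparison_def by blast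
  have homs: "Hom C c d \<subseteq> Hom E (G (F c)) (G (F d))" if "c \<in> Ob C" "d \<in> Ob C" for c d
  proof -
    have "Hom C c d \<subseteq> Hom D (F c) (F d)" using F that by (auto simp: slice_comparison_def)
    also have "\<dots> \<subseteq> Hom E (G (F c)) (G (F d))"
      using G ob that unfolding slice_comparison_def by blast
    finally show ?thesis .
  qed
  have "F c \<in> Ob D \<and> und D (F c) = und C c \<and> Id D (F c) = Id C c" if "c \<in> Ob C" for c
    using F that by (auto simp: slice_comparison_def)
  moreover have "G c \<in> Ob E \<and> und E (G c) = und D c \<and> Id E (G c) = Id D c" if "c \<in> Ob D" for c
    using G that by (auto simp: slice_comparison_def)
  moreover have "Comp D (F c) (F d) (F e) = Comp C c d e"
    if "c \<in> Ob C" "d \<in> Ob C" "e \<in> Ob C" for c d e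
    using F that unfolding slice_comparison_def by blast
  moreover have "Comp E (G c) (G d) (G e) = Comp D c d e"
    if "c \<in> Ob D" "d \<in> Ob D" "e \<in> Ob D" for c d e
    using G that unfolding slice_comparison_def by blast
  ultimately show ?thesis
    unfolding slice_comparison_def using hom bij' homs by simp
qed

lemma full_subcat_simps [simp]:
  "Ob (full_subcat C P) = {c \<in> Ob C. P c}" "Hom (full_subcat C P) = Hom C"
  "Id (full_subcat C P) = Id C" "Comp (full_subcat C P) = Comp C" "und (full_subcat C P) = und C"
  by (simp_all add: full_subcat_def)

text \<open>Every object of the slice over \<open>F c\<close> has the form \<open>F w\<close>, so it
  satisfies \<open>P\<close> already and the slice does not notice the restriction to the
  subcategory.\<close>

lemma slice_comparison_factor:
  assumes F: "slice_comparison F C D"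
    and P: "\<And>c. c \<in> Ob C \<Longrightarrow> P (F c)"
  shows "slice_comparison F C (full_subcat D P)"
proof -
  have ob: "F c \<in> Ob D" if "c \<in> Ob C" for c
    using F that by (auto simp: slice_comparison_def)
  have bij: "bij_betw (map_prod F id) (Ob (el_slice C c)) (Ob (el_slice D (F c)))" if "c \<in> Ob C" for c
    using F that by (auto simp: slice_comparison_def)
  have "Ob (el_slice (full_subcat D P) (F c)) = Ob (el_slice D (F c))" if c: "c \<in> Ob C" for c
  proof
    show "Ob (el_slice (full_subcat D P) (F c)) \<subseteq> Ob (el_slice D (F c))"
      by (auto simp: Ob_el_slice)
    show "Ob (el_slice D (F c)) \<subseteq> Ob (el_slice (full_subcat D P) (F c))"
    proof
      fix i assume i: "i \<in> Ob (el_slice D (F c))"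
      then have "i \<in> map_prod F id ` Ob (el_slice C c)"
        using bij_betw_imp_surj_on[OF bij[OF c]] by simp
      then obtain w p where "w \<in> Ob C" "i = (F w, p)" by (auto simp: Ob_el_slice)
      with P[of w] i show "i \<in> Ob (el_slice (full_subcat D P) (F c))" by (auto simp: Ob_el_slice)
    qed
  qed
  moreover have "Hom (el_slice (full_subcat D P) c) = Hom (el_slice D c)" for c
    by (simp add: el_slice_def)
  ultimately show ?thesis
    using F P unfolding slice_comparison_def by auto
qed

lemma slice_comparison_full_subcat:
  assumes "\<And>c w p. c \<in> Ob C \<Longrightarrow> P c \<Longrightarrow> w \<in> Ob C \<Longrightarrow> elementary (und C w) \<Longrightarrow> p \<in> Hom C w c \<Longrightarrow>
      inert (und C w) (und C c) p \<Longrightarrow> P w"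
  shows "slice_comparison (\<lambda>c. c) (full_subcat C P) C"
  by (rule slice_comparisonI) (use assms in auto)

section \<open>Transport of the Segal condition along a comparison\<close>

lemma segal_map_in_psh_lim:
  assumes Z: "presheaf C Z" and c: "c \<in> Ob C" and x: "x \<in> sec Z c"
  shows "segal_map C Z c x \<in> psh_lim (el_slice C c) (pullback el_dom Z)"
proof -
  have "act Z w c p x \<in> sec Z w" if "w \<in> Ob C" "p \<in> Hom C w c" for w p
    using Z c x that unfolding presheaf_def by blast
  then have 1: "segal_map C Z c x \<in> Pi\<^sub>E (Ob (el_slice C c)) (\<lambda>i. sec Z (fst i))"
    by (auto simp: segal_map_def Ob_el_slice)
  have "act Z w w' u (act Z w' c p' x) = act Z w c (Comp C w w' c p' u) x"
    if "w \<in> Ob C" "w' \<in> Ob C" "p' \<in> Hom C w' c" "u \<in> Hom C w w'" for w w' p' u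
    using Z c x that unfolding presheaf_def by metis
  then have "act Z (fst i) (fst j) u (segal_map C Z c x j) = segal_map C Z c x i"
    if "i \<in> Ob (el_slice C c)" "j \<in> Ob (el_slice C c)" "u \<in> Hom (el_slice C c) i j" for i j u
    using that by (cases i; cases j) (auto simp: segal_map_def Ob_el_slice Hom_el_slice)
  with 1 show ?thesis by (simp add: psh_lim_def pullback_def el_dom_def)
qed

text \<open>Reindexing compatible families along the bijection of slice objects is a bijection
  between the two limits, and it carries one Segal map to the other.\<close>

lemma segal_at_iff:
  fixes F :: "'c \<Rightarrow> 'd" and C :: "('c, 'a, 'v) graph_category" and Z :: "('d, ('a, 'v) gmap, 'x) psh"
  assumes "slice_comparison F C D" and Z: "presheaf D Z"
    and f: "f = \<lparr>on_ob = F, on_mor = (\<lambda>\<phi>. \<phi>)\<rparr>" and c: "c \<in> Ob C"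
  shows "bij_betw (segal_map C (pullback f Z) c) (sec (pullback f Z) c)
           (psh_lim (el_slice C c) (pullback el_dom (pullback f Z))) \<longleftrightarrow>
         bij_betw (segal_map D Z (F c)) (sec Z (F c))
           (psh_lim (el_slice D (F c)) (pullback el_dom Z))"
    (is "bij_betw _ _ ?LC \<longleftrightarrow> bij_betw _ _ ?LD")
proof -
  let ?I = "Ob (el_slice C c)" and ?J = "Ob (el_slice D (F c))"
    and ?b = "map_prod F (id :: ('a, 'v) gmap \<Rightarrow> ('a, 'v) gmap)"
  have bij: "bij_betw ?b ?I ?J"
    and hom: "\<And>i j. i \<in> ?I \<Longrightarrow> j \<in> ?I \<Longrightarrow> Hom (el_slice D (F c)) (?b i) (?b j) = Hom (el_slice C c) i j"
    using assms(1) c unfolding slice_comparison_def by blast+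
  have img: "?b ` ?I = ?J" and inj: "inj_on ?b ?I" using bij by (auto simp: bij_betw_def)
  \<comment> \<open>Restricting to \<open>?I\<close> makes the reindexed family extensional, as
    elements of the limit have to be.\<close>
  define R where "R s = (\<lambda>i\<in>?I. s (?b i))" for s :: "'d \<times> ('a, 'v) gmap \<Rightarrow> 'x"
  have R: "bij_betw R ?LD ?LC"
  proof (rule bij_betw_byWitness)
    define R' where "R' s = (\<lambda>j\<in>?J. s (inv_into ?I ?b j))" for s :: "'c \<times> ('a, 'v) gmap \<Rightarrow> 'x"
    have inv1: "inv_into ?I ?b (?b i) = i" if "i \<in> ?I" for i using inj that by simp
    have inv2: "?b (inv_into ?I ?b j) = j" "inv_into ?I ?b j \<in> ?I" if "j \<in> ?J" for j
      using that img f_inv_into_f[of j ?b ?I] inv_into_into[of j ?b ?I] by auto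
    have b_in: "?b i \<in> ?J" if "i \<in> ?I" for i using that img by blast
    have fst_b: "fst (?b i) = F (fst i)" for i by (cases i) auto
    have fst_inv: "F (fst (inv_into ?I ?b j)) = fst j" if "j \<in> ?J" for j
      using inv2(1)[OF that] fst_b[of "inv_into ?I ?b j"] by simp
    have LD: "s \<in> ?LD \<longleftrightarrow> s \<in> extensional ?J \<and> (\<forall>j\<in>?J. s j \<in> sec Z (fst j)) \<and>
        (\<forall>i\<in>?J. \<forall>j\<in>?J. \<forall>u\<in>Hom (el_slice D (F c)) i j. act Z (fst i) (fst j) u (s j) = s i)" for s
      unfolding psh_lim_def pullback_def el_dom_def by (simp add: PiE_iff conj_ac)
    have LC: "s \<in> ?LC \<longleftrightarrow> s \<in> extensional ?I \<and> (\<forall>j\<in>?I. s j \<in> sec Z (F (fst j))) \<and>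
        (\<forall>i\<in>?I. \<forall>j\<in>?I. \<forall>u\<in>Hom (el_slice C c) i j. act Z (F (fst i)) (F (fst j)) u (s j) = s i)" for s
      unfolding psh_lim_def pullback_def el_dom_def f by (simp add: PiE_iff conj_ac)
    show "\<forall>s\<in>?LD. R' (R s) = s"
    proof
      fix s assume "s \<in> ?LD"
      then have "s \<in> extensional ?J" unfolding LD by blast
      then show "R' (R s) = s"
        by (intro extensionalityI[where A = ?J]) (auto simp only: R_def R'_def inv2 restrict_apply restrict_extensional if_True)
    qed
    show "\<forall>s\<in>?LC. R (R' s) = s"
    proof
      fix s assume "s \<in> ?LC"
      then have "s \<in> extensional ?I" unfolding LC by blast
      then show "R (R' s) = s"
        by (intro extensionalityI[where A = ?I]) (auto simp only: R_def R'_def inv1 b_in restrict_apply restrict_extensional if_True)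
    qed
    have "R s \<in> ?LC" if s: "s \<in> ?LD" for s
      unfolding LC
    proof (intro conjI ballI)
      fix i assume i: "i \<in> ?I"
      have "s (?b i) \<in> sec Z (fst (?b i))" using s b_in[OF i] unfolding LD by blast
      then show "R s i \<in> sec Z (F (fst i))"
        unfolding R_def using i by (simp only: fst_b restrict_apply')
      fix j u assume j: "j \<in> ?I" and u: "u \<in> Hom (el_slice C c) i j"
      have "act Z (fst (?b i)) (fst (?b j)) u (s (?b j)) = s (?b i)"
        using s b_in[OF i] b_in[OF j] u hom[OF i j] unfolding LD by blast
      then show "act Z (F (fst i)) (F (fst j)) u (R s j) = R s i"
        unfolding R_def using i j by (simp only: fst_b restrict_apply')
    qed (simp add: R_def)
    then show "R ` ?LD \<subseteq> ?LC" by blast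
    have "R' s \<in> ?LD" if s: "s \<in> ?LC" for s
      unfolding LD
    proof (intro conjI ballI)
      fix i assume i: "i \<in> ?J"
      have "s (inv_into ?I ?b i) \<in> sec Z (F (fst (inv_into ?I ?b i)))"
        using s inv2(2)[OF i] unfolding LC by blast
      then show "R' s i \<in> sec Z (fst i)"
        unfolding R'_def using i by (simp only: fst_inv restrict_apply')
      fix j u assume j: "j \<in> ?J" and u: "u \<in> Hom (el_slice D (F c)) i j"
      have "act Z (F (fst (inv_into ?I ?b i))) (F (fst (inv_into ?I ?b j))) u (s (inv_into ?I ?b j)) =
          s (inv_into ?I ?b i)"
        using s inv2[OF i] inv2[OF j] u hom[OF inv2(2)[OF i] inv2(2)[OF j]] unfolding LC
        by (simp only:)
      then show "act Z (fst i) (fst j) u (R' s j) = R' s i"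
        unfolding R'_def using i j by (simp only: fst_inv restrict_apply')
    qed (simp add: R'_def)
    then show "R' ` ?LC \<subseteq> ?LD" by blast
  qed
  have "segal_map C (pullback f Z) c x = (R \<circ> segal_map D Z (F c)) x" for x
  proof
    fix i
    show "segal_map C (pullback f Z) c x i = (R \<circ> segal_map D Z (F c)) x i"
    proof (cases "i \<in> ?I")
      case True
      moreover have "?b i \<in> ?J" using True img by blast
      ultimately show ?thesis
        by (cases i) (simp add: segal_map_def R_def pullback_def f)
    qed (simp add: segal_map_def R_def)
  qed
  then have eq: "segal_map C (pullback f Z) c = R \<circ> segal_map D Z (F c)" by blast
  have sec: "sec (pullback f Z) c = sec Z (F c)" by (simp add: pullback_def f)
  show ?thesis
  proof
    assume "bij_betw (segal_map D Z (F c)) (sec Z (F c)) ?LD"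
    then show "bij_betw (segal_map C (pullback f Z) c) (sec (pullback f Z) c) ?LC"
      unfolding eq sec using R by (rule bij_betw_trans)
  next
    assume L: "bij_betw (segal_map C (pullback f Z) c) (sec (pullback f Z) c) ?LC"
    have "F c \<in> Ob D" using assms(1) c by (auto simp: slice_comparison_def)
    \<comment> \<open>\<open>R\<close> is bijective only on compatible families; the Segal map must
      be known to take values there before bijectivity of its composite with \<open>R\<close> can be
      cancelled.\<close>
    then have into: "segal_map D Z (F c) \<in> sec Z (F c) \<rightarrow> ?LD"
      using segal_map_in_psh_lim[OF Z] by blast
    then show "bij_betw (segal_map D Z (F c)) (sec Z (F c)) ?LD"
      using bij_betw_comp_iff2[OF R, of "segal_map D Z (F c)" "sec Z (F c)"] L
      unfolding eq sec by blast
  qed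
qed

lemma presheaf_pullback:
  assumes "slice_comparison F C D" and f: "f = \<lparr>on_ob = F, on_mor = (\<lambda>\<phi>. \<phi>)\<rparr>" and Z: "presheaf D Z"
  shows "presheaf C (pullback f Z)"
proof -
  have F: "\<And>c. c \<in> Ob C \<Longrightarrow> F c \<in> Ob D" "\<And>c. c \<in> Ob C \<Longrightarrow> Id D (F c) = Id C c"
    "\<And>c d \<phi>. c \<in> Ob C \<Longrightarrow> d \<in> Ob C \<Longrightarrow> \<phi> \<in> Hom C c d \<Longrightarrow> \<phi> \<in> Hom D (F c) (F d)"
    "\<And>c d e. c \<in> Ob C \<Longrightarrow> d \<in> Ob C \<Longrightarrow> e \<in> Ob C \<Longrightarrow> Comp D (F c) (F d) (F e) = Comp C c d e"
    using assms(1) unfolding slice_comparison_def by blast+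
  show ?thesis
    unfolding presheaf_def pullback_def f
  proof (intro conjI ballI; simp)
    fix c d \<phi> assume "c \<in> Ob C" "d \<in> Ob C" "\<phi> \<in> Hom C c d"
    then show "act Z (F c) (F d) \<phi> \<in> sec Z (F d) \<rightarrow> sec Z (F c)"
      using Z F unfolding presheaf_def by blast
  next
    fix c x assume "c \<in> Ob C" "x \<in> sec Z (F c)"
    then show "act Z (F c) (F c) (Id C c) x = x"
      using Z F unfolding presheaf_def by metis
  next
    fix c d e \<phi> \<psi> x
    assume "c \<in> Ob C" "d \<in> Ob C" "e \<in> Ob C" "\<phi> \<in> Hom C c d" "\<psi> \<in> Hom C d e" "x \<in> sec Z (F e)"
    then show "act Z (F c) (F e) (Comp C c d e \<psi> \<phi>) x =
        act Z (F c) (F d) \<phi> (act Z (F d) (F e) \<psi> x)"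
      using Z F unfolding presheaf_def by metis
  qed
qed

lemma segal_pullback:
  assumes "slice_comparison F C D" and "f = \<lparr>on_ob = F, on_mor = (\<lambda>\<phi>. \<phi>)\<rparr>" and "segal D Z"
  shows "segal C (pullback f Z)"
proof -
  have "presheaf D Z" using assms(3) by (simp add: segal_def)
  moreover have "F c \<in> Ob D" if "c \<in> Ob C" for c
    using assms(1) that by (simp add: slice_comparison_def)
  ultimately show ?thesis
    using assms segal_at_iff[OF assms(1) _ assms(2)] presheaf_pullback[OF assms(1,2)]
    unfolding segal_def by blast
qed

text \<open>The Segal condition at \<open>d\<close> is equivalent to that of the pullback at any
  \<open>c\<close> with \<open>F c = d\<close>, so it suffices that \<open>F\<close> hits every
  object on the nose.\<close>

lemma segal_reflect:
  assumes "slice_comparison F C D" and "f = \<lparr>on_ob = F, on_mor = (\<lambda>\<phi>. \<phi>)\<rparr>"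
    and surj: "\<And>d. d \<in> Ob D \<Longrightarrow> \<exists>c\<in>Ob C. F c = d"
    and "presheaf D Z" and "segal C (pullback f Z)"
  shows "segal D Z"
  unfolding segal_def
proof (intro conjI ballI)
  fix d assume "d \<in> Ob D"
  then obtain c where c: "c \<in> Ob C" and [simp]: "F c = d" using surj by blast
  show "bij_betw (segal_map D Z d) (sec Z d) (psh_lim (el_slice D d) (pullback el_dom Z))"
    using assms(5) c segal_at_iff[OF assms(1,4,2) c] unfolding segal_def by simp
qed fact

section \<open>Trees and orientations\<close>

lemma graph_dataD:
  assumes "graph_data G"
  shows "finite (arcs G)" "finite (verts G)" "dag G \<in> extensional (arcs G)"
    "\<And>a. a \<in> arcs G \<Longrightarrow> dag G a \<in> arcs G" "\<And>a. a \<in> arcs G \<Longrightarrow> dag G (dag G a) = a"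
    "\<And>a. a \<in> arcs G \<Longrightarrow> dag G a \<noteq> a" "\<And>a. a \<in> darcs G \<Longrightarrow> a \<in> arcs G"
    "\<And>a. a \<in> darcs G \<Longrightarrow> tgt G a \<in> verts G" "tgt G \<in> extensional (darcs G)"
  using assms by (auto simp: graph_data_def PiE_def)

text \<open>Closure of the complement is a separate premise because \<open>subgraph_data\<close>
  only passes from arcs to their targets: an arc outside \<open>A\<close> might still end in
  \<open>V\<close>.\<close>

lemma connected_graph_split:
  assumes "connected_graph G" "subgraph_data G A V" "subgraph_data G (arcs G - A) (verts G - V)"
    and "A \<noteq> {} \<or> V \<noteq> {}"
  shows "A = arcs G" "V = verts G"
proof -
  have "A \<subseteq> arcs G" "V \<subseteq> verts G" using assms(2) by (auto simp: subgraph_data_def)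
  moreover have "A \<union> (arcs G - A) = arcs G \<and> A \<inter> (arcs G - A) = {} \<and>
      V \<union> (verts G - V) = verts G \<and> V \<inter> (verts G - V) = {}"
    using calculation by blast
  then have "\<not> (arcs G - A \<noteq> {} \<or> verts G - V \<noteq> {})"
    using assms unfolding connected_graph_def by blast
  ultimately show "A = arcs G" "V = verts G" by auto
qed

text \<open>
  A walk yields a cycle from its first return to a vertex. Backtracking at the initial vertex is
  harmless: it does not occur before the first return.
\<close>

lemma cycle_of_walk:
  assumes G: "graph_data G"
    and s: "\<And>i. s i \<in> darcs G" "\<And>i. dag G (s i) \<in> darcs G"
      "\<And>i. tgt G (dag G (s i)) = tgt G (s (Suc i))"
    and no_backtrack: "\<And>i. tgt G (s (Suc i)) \<noteq> tgt G (s 0) \<Longrightarrow> s (Suc i) \<noteq> dag G (s i)"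
  shows "\<exists>as. is_cycle G as"
proof -
  define t where "t i = tgt G (s i)" for i
  have "range t \<subseteq> verts G" using graph_dataD(8)[OF G s(1)] by (auto simp: t_def)
  then have "finite (range t)" using graph_dataD(2)[OF G] by (rule finite_subset)
  then have "\<not> inj t" using finite_imageD[of t UNIV] infinite_UNIV_nat by blast
  then have ex: "\<exists>j. \<exists>i<j. t i = t j"
    by (rule contrapos_np) (auto intro!: linorder_inj_onI')
  \<comment> \<open>\<open>j\<close> is the first index at which a target repeats and
    \<open>i\<close> the earlier occurrence; the cycle consists of
    \<open>s i, ..., s (j - 1)\<close>.\<close>
  define j where "j = (LEAST j. \<exists>i<j. t i = t j)"
  obtain i where i: "i < j" "t i = t j" using LeastI_ex[OF ex] unfolding j_def by blast
  have min: "t p \<noteq> t q" if "p < q" "q < j" for p q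
    using not_less_Least[of q "\<lambda>j. \<exists>i<j. t i = t j"] that unfolding j_def by blast
  have tneq: "p = q" if "t p = t q" "p < j" "q < j" for p q
    using min that by (metis linorder_neqE_nat)
  \<comment> \<open>Two arcs on one edge with different targets are partners, which forces
    \<open>q = Suc p\<close>. Since \<open>Suc p < j\<close>, the vertex reached there is not the
    initial one, so turning back is forbidden.\<close>
  have edge: "False" if pq: "p < q" "q < j" and e: "edge_of G (s p) = edge_of G (s q)" for p q
  proof -
    have "s q = s p \<or> s q = dag G (s p)" using e by (auto simp: edge_of_def doubleton_eq_iff)
    moreover have "s q \<noteq> s p" using min[OF pq] by (auto simp: t_def)
    ultimately have q: "s q = dag G (s p)" by blast
    then have "t q = t (Suc p)" using s(3)[of p] by (simp add: t_def)
    then have "q = Suc p" using tneq[of q "Suc p"] pq by simp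
    moreover have "t (Suc p) \<noteq> t 0" using min[of 0 "Suc p"] pq by simp
    ultimately show False using no_backtrack[of p] q by (simp add: t_def)
  qed
  define as where "as = map s [i..<j]"
  have len: "length as = j - i" and nth: "\<And>k. k < j - i \<Longrightarrow> as ! k = s (i + k)"
    by (simp_all add: as_def)
  have "tgt G (dag G (as ! k)) = tgt G (as ! (Suc k mod length as))" if k: "k < j - i" for k
  proof (cases "Suc k = j - i")
    case True
    then have "Suc (i + k) = j" using i(1) by simp
    then show ?thesis using True k s(3)[of "i + k"] i nth[of 0] nth[OF k] by (simp add: len t_def)
  next
    case False
    then show ?thesis using k s(3)[of "i + k"] nth by (simp add: len)
  qed
  moreover have "distinct (map (tgt G) as)"
  proof -
    have "inj_on t {i..<j}" using tneq by (auto simp: inj_on_def)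
    then show ?thesis by (simp add: as_def distinct_map comp_def t_def[symmetric])
  qed
  moreover have "distinct (map (edge_of G) as)"
  proof -
    have "inj_on (\<lambda>k. edge_of G (s k)) {i..<j}"
      by (rule inj_onI, rule ccontr) (metis atLeastLessThan_iff edge linorder_neqE_nat)
    then show ?thesis by (simp add: as_def distinct_map comp_def)
  qed
  ultimately have "is_cycle G as"
    unfolding is_cycle_def using s i(1) nth by (auto simp: len as_def)
  then show ?thesis by blast
qed

section \<open>Orientations and directed cycles in trees\<close>

lemma orientationD:
  assumes "orientation G x" "a \<in> arcs G"
  shows "x a = 1 \<or> x a = -1" "x (dag G a) = - x a"
  using assms by (auto simp: orientation_def)

text \<open>The condition on \<open>T\<close> says that no edge is prescribed in both directions.
  Edges that avoid \<open>T\<close> are oriented by an auxiliary numbering \<open>r\<close>, which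
  separates the two arcs of an edge.\<close>

lemma orientation_exists:
  assumes G: "graph_data G" and T: "T \<subseteq> arcs G" "T \<inter> dag G ` T = {}"
  shows "\<exists>x. orientation G x \<and> (\<forall>a\<in>T. x a = 1)"
proof -
  obtain r :: "'a \<Rightarrow> nat" where r: "inj_on r (arcs G)"
    using finite_imp_inj_to_nat_seg[OF graph_dataD(1)[OF G]] by blast
  define x where "x = (\<lambda>a\<in>arcs G. if a \<in> T then 1 else if dag G a \<in> T then -1 else
      if r a < r (dag G a) then 1 else -1 :: int)"
  have "x (dag G a) = - x a" if a: "a \<in> arcs G" for a
  proof -
    have "r a \<noteq> r (dag G a)" using r a graph_dataD(4,6)[OF G a] by (metis inj_onD)
    moreover have "\<not> (a \<in> T \<and> dag G a \<in> T)" using T(2) by blast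
    ultimately show ?thesis using a graph_dataD(4,5)[OF G a] by (auto simp: x_def)
  qed
  then have "orientation G x" by (auto simp: orientation_def x_def)
  moreover have "\<forall>a\<in>T. x a = 1" using T(1) by (auto simp: x_def)
  ultimately show ?thesis by blast
qed

text \<open>Repeating the outgoing arcs of a closed directed path periodically gives a walk. It
  never turns back, because its arcs have sign \<open>1\<close> and their partners sign
  \<open>-1\<close>.\<close>

lemma tree_acyclic:
  assumes tree: "is_tree G" and x: "orientation G x"
  shows "acyclic_ograph (G, x)"
  unfolding acyclic_ograph_def
proof (rule notI, elim exE conjE)
  fix es vs assume p: "directed_path (G, x) es vs" and ne: "vs \<noteq> []" and closed: "hd es = last es"
  have G: "graph_data G" using tree by (simp add: is_tree_def is_graph_def)
  define n where "n = length vs"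
  have n: "n > 0" and les: "length es = Suc n" using ne p by (simp_all add: n_def directed_path_def)
  have closed: "es ! 0 = es ! n" using closed les by (metis hd_conv_nth last_conv_nth diff_Suc_1 list.size(3) nat.distinct(1))
  have "\<exists>d. d \<in> es ! Suc i \<and> d \<in> darcs G \<and> tgt G d = vs ! i \<and> x d = 1" if "i < n" for i
    using p that by (auto simp: directed_path_def out_arcs_def nb_def n_def)
  then obtain out where out: "\<And>i. i < n \<Longrightarrow> out i \<in> es ! Suc i \<and> out i \<in> darcs G \<and>
      tgt G (out i) = vs ! i \<and> x (out i) = 1" by metis
  have "\<exists>d. d \<in> es ! i \<and> d \<in> darcs G \<and> tgt G d = vs ! i \<and> x d = -1" if "i < n" for i
    using p that by (auto simp: directed_path_def in_arcs_def nb_def n_def)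
  then obtain inn where inn: "\<And>i. i < n \<Longrightarrow> inn i \<in> es ! i \<and> inn i \<in> darcs G \<and>
      tgt G (inn i) = vs ! i \<and> x (inn i) = -1" by metis
  have edge: "\<exists>a\<in>arcs G. es ! i = {a, dag G a}" if "i \<le> n" for i
  proof -
    have "es ! i \<in> edges G" using p that les by (auto simp: directed_path_def)
    then show ?thesis by (auto simp: edges_def edge_of_def)
  qed
  have same_edge: "d' = dag G d"
    if "i \<le> n" "d \<in> es ! i" "d' \<in> es ! i" "x d = 1" "x d' = -1" for i d d'
    using edge[OF that(1)] that graph_dataD(5)[OF G] by auto
  define s where "s i = out (i mod n)" for i
  have next_in: "inn (Suc i mod n) = dag G (s i)" for i
  proof -
    \<comment> \<open>At the wrap-around this is the equality of the first and the last
      edge.\<close>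
    have "es ! (Suc i mod n) = es ! Suc (i mod n)" using n closed by (simp add: mod_Suc)
    then show ?thesis
      using same_edge[of "Suc (i mod n)" "s i" "inn (Suc i mod n)"]
        out[of "i mod n"] inn[of "Suc i mod n"] n by (simp add: s_def Suc_le_eq)
  qed
  have s: "s i \<in> darcs G" "x (s i) = 1" "tgt G (s i) = vs ! (i mod n)" for i
    using out[of "i mod n"] n by (simp_all add: s_def)
  have d: "dag G (s i) \<in> darcs G" "x (dag G (s i)) = -1" "tgt G (dag G (s i)) = vs ! (Suc i mod n)" for i
    using inn[of "Suc i mod n"] n by (simp_all add: next_in[symmetric])
  have "\<exists>as. is_cycle G as"
  proof (rule cycle_of_walk[OF G s(1) d(1)])
    show "tgt G (dag G (s i)) = tgt G (s (Suc i))" for i using d(3) s(3) by simp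
    show "s (Suc i) \<noteq> dag G (s i)" for i using s(2)[of "Suc i"] d(2)[of i] by auto
  qed
  then show False using tree by (simp add: is_tree_def)
qed

text \<open>Without boundary every arc ends at a vertex, so outgoing arcs can be followed forever,
  and the signs exclude turning back. This puts dendroidal trees into
  \<open>cat_Ucyc\<close>.\<close>

lemma boundary_nonempty:
  assumes tree: "is_tree G" and x: "orientation G x"
    and out: "\<And>v. v \<in> verts G \<Longrightarrow> out_arcs (G, x) v \<noteq> {}"
  shows "boundary G \<noteq> {}"
proof
  assume B: "boundary G = {}"
  have G: "graph_data G" and conn: "connected_graph G" and nl: "\<not> nodeless G"
    using tree by (simp_all add: is_tree_def is_graph_def)
  have darcs: "darcs G = arcs G" using B nl graph_dataD(7)[OF G] by (auto simp: boundary_def)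
  then have "verts G \<noteq> {}" using conn graph_dataD(8)[OF G] unfolding connected_graph_def by blast
  then obtain v0 where v0: "v0 \<in> verts G" by blast
  have "\<exists>d. d \<in> darcs G \<and> tgt G d = v \<and> x d = 1" if "v \<in> verts G" for v
    using out[OF that] by (auto simp: out_arcs_def nb_def)
  then obtain f where f: "\<And>v. v \<in> verts G \<Longrightarrow> f v \<in> darcs G \<and> tgt G (f v) = v \<and> x (f v) = 1"
    by metis
  define s where "s i = ((\<lambda>a. f (tgt G (dag G a))) ^^ i) (f v0)" for i
  have s_Suc: "s (Suc i) = f (tgt G (dag G (s i)))" for i by (simp add: s_def)
  have dd: "dag G a \<in> darcs G" if "a \<in> darcs G" for a
    using that graph_dataD(4)[OF G] by (simp add: darcs)
  have s: "s i \<in> darcs G \<and> x (s i) = 1" for i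
  proof (induction i)
    case 0
    then show ?case using f[OF v0] by (simp add: s_def)
  next
    case (Suc i)
    then show ?case unfolding s_Suc using f graph_dataD(8)[OF G dd] by blast
  qed
  have "\<exists>as. is_cycle G as"
  proof (rule cycle_of_walk[OF G])
    fix i
    show "s i \<in> darcs G" "dag G (s i) \<in> darcs G" using s dd by blast+
    then show "tgt G (dag G (s i)) = tgt G (s (Suc i))"
      using f graph_dataD(8)[OF G] by (simp add: s_Suc)
    have "x (dag G (s i)) = -1"
      using s[of i] graph_dataD(7)[OF G, of "s i"] orientationD(2)[OF x, of "s i"] by simp
    then show "s (Suc i) \<noteq> dag G (s i)" using s[of "Suc i"] by auto
  qed
  then show False using tree by (simp add: is_tree_def)
qed

section \<open>Orienting a tree towards a boundary arc\<close>

text \<open>\<open>F\<close> is the arc set of some internal edges, and \<open>a\<close> sits at a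
  leaf of the forest that they span. If there were no leaf apart from \<open>v0\<close>, every other
  vertex could be left by an arc different from the one of arrival, giving a walk that turns back at
  most at \<open>v0\<close>.\<close>

lemma leaf_exists:
  assumes G: "graph_data G" and acyc: "\<not> (\<exists>as. is_cycle G as)"
    and F: "F \<subseteq> darcs G" "dag G ` F \<subseteq> F" "F \<noteq> {}"
  shows "\<exists>a\<in>F. tgt G a \<noteq> v0 \<and> (\<forall>a'\<in>F. tgt G a' = tgt G a \<longrightarrow> a' = a)"
proof (rule ccontr)
  assume "\<not> ?thesis"
  then have other: "\<exists>a'. a' \<in> F \<and> tgt G a' = tgt G a \<and> a' \<noteq> a" if "a \<in> F" "tgt G a \<noteq> v0" for a
    using that by blast
  \<comment> \<open>\<open>a'\<close> may continue a walk arriving along the partner of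
    \<open>a\<close>; turning back, \<open>a' = a\<close>, is allowed only at
    \<open>v0\<close>.\<close>
  define good where "good a a' \<longleftrightarrow> a' \<in> F \<and> tgt G a' = tgt G a \<and> (a' = a \<longrightarrow> tgt G a = v0)" for a a'
  have "\<exists>a'. good a a'" if "a \<in> F" for a
    using other[OF that] that unfolding good_def by blast
  then obtain nxt where nxt: "\<And>a. a \<in> F \<Longrightarrow> good a (nxt a)" by metis
  \<comment> \<open>Starting at \<open>v0\<close> whenever \<open>F\<close> meets it makes
    \<open>v0\<close> the initial vertex, the one place where \<open>cycle_of_walk\<close> tolerates
    turning back.\<close>
  obtain a0 where a0: "a0 \<in> F" "tgt G a0 = v0 \<or> (\<forall>a\<in>F. tgt G a \<noteq> v0)" using F(3) by blast
  define s where "s i = ((\<lambda>a. nxt (dag G a)) ^^ i) a0" for i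
  have s_Suc: "s (Suc i) = nxt (dag G (s i))" for i by (simp add: s_def)
  have sF: "s i \<in> F" for i
  proof (induction i)
    case 0
    then show ?case using a0 by (simp add: s_def)
  next
    case (Suc i)
    then show ?case unfolding s_Suc using nxt F(2) unfolding good_def by blast
  qed
  have "\<exists>as. is_cycle G as"
  proof (rule cycle_of_walk[OF G])
    fix i
    show "s i \<in> darcs G" "dag G (s i) \<in> darcs G" using sF F by blast+
    have g: "good (dag G (s i)) (s (Suc i))" unfolding s_Suc using nxt sF F(2) by blast
    then show "tgt G (dag G (s i)) = tgt G (s (Suc i))" by (simp add: good_def)
    assume neq: "tgt G (s (Suc i)) \<noteq> tgt G (s 0)"
    have "tgt G (s (Suc i)) \<noteq> v0" using neq a0(2) sF[of "Suc i"] by (auto simp: s_def)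
    then show "s (Suc i) \<noteq> dag G (s i)" using g by (auto simp: good_def)
  qed
  then show False using acyc by blast
qed

text \<open>\<open>P\<close> selects from each edge the arc at its child end, for a rooting of the
  forest in which \<open>v0\<close> is a root. It is built by removing the edge of a leaf at a time:
  the leaf becomes the child end of that edge.\<close>

lemma parent_arcs_exist:
  assumes G: "graph_data G" and acyc: "\<not> (\<exists>as. is_cycle G as)"
    and "finite F" "F \<subseteq> darcs G" "dag G ` F \<subseteq> F"
  shows "\<exists>P\<subseteq>F. (\<forall>a\<in>F. a \<in> P \<longleftrightarrow> dag G a \<notin> P) \<and> inj_on (tgt G) P \<and> v0 \<notin> tgt G ` P"
  using assms(3-5)
proof (induction F rule: finite_psubset_induct)
  case (psubset F)
  show ?case
  proof (cases "F = {}")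
    case False
    then obtain a where a: "a \<in> F" "tgt G a \<noteq> v0" "\<And>a'. a' \<in> F \<Longrightarrow> tgt G a' = tgt G a \<Longrightarrow> a' = a"
      using leaf_exists[OF G acyc psubset.prems] by metis
    have inv: "dag G (dag G c) = c" "dag G c \<noteq> c" "dag G c \<in> F" if "c \<in> F" for c
      using that psubset.prems graph_dataD(5,6,7)[OF G] by auto
    let ?F = "F - {a, dag G a}"
    have "dag G ` ?F \<subseteq> ?F"
    proof (rule image_subsetI)
      fix c assume c: "c \<in> ?F"
      then have "dag G c \<noteq> a" "dag G c \<noteq> dag G a" using inv(1)[of c] inv(1)[OF a(1)] by auto
      then show "dag G c \<in> ?F" using c inv(3) by blast
    qed
    moreover have "?F \<subset> F" "?F \<subseteq> darcs G" using psubset.prems(1) a(1) by blast+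
    ultimately have "\<exists>P\<subseteq>?F. (\<forall>a\<in>?F. a \<in> P \<longleftrightarrow> dag G a \<notin> P) \<and> inj_on (tgt G) P \<and> v0 \<notin> tgt G ` P"
      by (intro psubset.IH)
    then obtain P where P: "P \<subseteq> ?F" "\<And>c. c \<in> ?F \<Longrightarrow> c \<in> P \<longleftrightarrow> dag G c \<notin> P" "inj_on (tgt G) P"
      "v0 \<notin> tgt G ` P"
      by auto
    have "c \<in> insert a P \<longleftrightarrow> dag G c \<notin> insert a P" if c: "c \<in> F" for c
    proof (cases "c = a \<or> c = dag G a")
      case True
      then show ?thesis using inv[OF a(1)] P(1) by auto
    next
      case False
      then have "dag G c \<noteq> a" using inv(1)[OF c] by auto
      then show ?thesis using False P(2)[of c] c by blast
    qed
    \<comment> \<open>No arc of \<open>P\<close> ends at the leaf, since \<open>a\<close> is the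
      only arc of \<open>F\<close> there.\<close>
    moreover have "inj_on (tgt G) (insert a P)"
      using P(1,3) a(3) by (auto simp: inj_on_def)
    ultimately show ?thesis using P a by (intro exI[of _ "insert a P"]) auto
  qed simp
qed

text \<open>The output of a vertex is the arc leading towards \<open>b\<close>: the partner
  \<open>r\<close> of \<open>b\<close> at \<open>v0\<close>, and the arc to the parent elsewhere.
  \<open>parent_arcs_exist\<close> yields at most one parent arc for each vertex; connectedness
  yields at least one.\<close>

lemma rooted_orientation:
  assumes tree: "is_tree G" and B: "boundary G \<noteq> {}"
  shows "\<exists>x. orientation G x \<and> (\<forall>v\<in>verts G. is_singleton (out_arcs (G, x) v))"
proof -
  have G: "graph_data G" and conn: "connected_graph G" and acyc: "\<not> (\<exists>as. is_cycle G as)"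
    and nl: "\<not> nodeless G"
    using tree by (simp_all add: is_tree_def is_graph_def)
  note Gd = graph_dataD[OF G]
  obtain b where b: "b \<in> arcs G" "b \<notin> darcs G" using B nl by (auto simp: boundary_def)
  define r where "r = dag G b"
  have r: "r \<in> arcs G" "dag G r = b" "r \<noteq> b" using Gd b by (auto simp: r_def)
  show ?thesis
  proof (cases "r \<in> darcs G")
    \<comment> \<open>Neither arc of this edge ends at a vertex, so the edge is a component and
      \<open>G\<close> has no vertices.\<close>
    case False
    have dag_br: "dag G a \<in> {b, r} \<longleftrightarrow> a \<in> {b, r}" if "a \<in> arcs G" for a
      using Gd(5)[OF that] r(2) unfolding insert_iff empty_iff r_def by metis
    have "subgraph_data G {b, r} {}" using b r False by (auto simp: subgraph_data_def r_def)
    moreover have "subgraph_data G (arcs G - {b, r}) (verts G - {})"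
      using Gd(4,8) dag_br unfolding subgraph_data_def by blast
    ultimately have "verts G = {}" using connected_graph_split(2)[OF conn] by blast
    then show ?thesis using orientation_exists[OF G, of "{}"] by auto
  next
    case True
    define v0 where "v0 = tgt G r"
    define F where "F = {a \<in> darcs G. dag G a \<in> darcs G}"
    have "finite F" "F \<subseteq> darcs G" "dag G ` F \<subseteq> F"
      using Gd by (auto simp: F_def intro: finite_subset[of _ "arcs G"])
    then obtain P where P: "P \<subseteq> F" "\<And>c. c \<in> F \<Longrightarrow> c \<in> P \<longleftrightarrow> dag G c \<notin> P" "inj_on (tgt G) P"
      "v0 \<notin> tgt G ` P"
      using parent_arcs_exist[OF G acyc] by metis
    \<comment> \<open>The vertices from which iterated passage to the parent leads to
      \<open>v0\<close>.\<close>
    define R where "R = {v. (v, v0) \<in> {(tgt G p, tgt G (dag G p)) | p. p \<in> P}\<^sup>*}"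
    have v0R: "v0 \<in> R" by (simp add: R_def)
    have R_step: "tgt G p \<in> R" if "p \<in> P" "tgt G (dag G p) \<in> R" for p
      using that unfolding R_def by (auto intro: converse_rtrancl_into_rtrancl)
    have R_cases: "v = v0 \<or> (\<exists>p\<in>P. v = tgt G p \<and> tgt G (dag G p) \<in> R)" if "v \<in> R" for v
      using that unfolding R_def by (auto elim: converse_rtranclE)
    \<comment> \<open>An arc in \<open>P\<close> leads from a child to its parent, and the parent is
      unique by injectivity of \<open>tgt G\<close> on \<open>P\<close>; the partner of an arc in
      \<open>P\<close> leads to a child.\<close>
    have R_adj: "tgt G (dag G a) \<in> R" if a: "a \<in> F" and aR: "tgt G a \<in> R" for a
    proof (cases "a \<in> P")
      case True
      then obtain p where "p \<in> P" "tgt G a = tgt G p" "tgt G (dag G p) \<in> R"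
        using R_cases[OF aR] P(4) by auto
      then show ?thesis using P(3) True by (auto dest: inj_onD)
    next
      case False
      then have "dag G a \<in> P" using P(2)[OF a] by blast
      moreover have "dag G (dag G a) = a" using a Gd by (auto simp: F_def)
      ultimately show ?thesis using R_step[of "dag G a"] aR by simp
    qed
    \<comment> \<open>Both arcs of every edge with an end in \<open>R\<close>. By
      \<open>R_adj\<close> this gives a closed piece with closed complement, so \<open>R\<close>
      contains all vertices.\<close>
    define A where "A = {a \<in> arcs G. (a \<in> darcs G \<and> tgt G a \<in> R) \<or> (dag G a \<in> darcs G \<and> tgt G (dag G a) \<in> R)}"
    have AR: "tgt G a \<in> R" if "a \<in> A" "a \<in> darcs G" for a
    proof (cases "tgt G a \<in> R")
      case False
      then have d: "dag G a \<in> darcs G" "tgt G (dag G a) \<in> R" using that by (auto simp: A_def)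
      then have "dag G a \<in> F" using that Gd by (auto simp: F_def)
      then show ?thesis using R_adj[OF _ d(2)] Gd that(2) by simp
    qed
    have dA: "dag G a \<in> A \<longleftrightarrow> a \<in> A" if "a \<in> arcs G" for a
      using that Gd by (auto simp: A_def)
    have "subgraph_data G A (R \<inter> verts G)"
      unfolding subgraph_data_def using AR dA Gd by (auto simp: A_def)
    moreover have "subgraph_data G (arcs G - A) (verts G - (R \<inter> verts G))"
      unfolding subgraph_data_def using dA Gd by (auto simp: A_def)
    moreover have "v0 \<in> verts G" using Gd True by (simp add: v0_def)
    ultimately have "R \<inter> verts G = verts G"
      using connected_graph_split(2)[OF conn] v0R by blast
    then have parent: "\<exists>p\<in>P. tgt G p = v" if "v \<in> verts G" "v \<noteq> v0" for v
      using R_cases[of v] that by blast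
    \<comment> \<open>The arcs that are to have sign \<open>1\<close>: parent arcs, the root arc,
      and all boundary arcs other than \<open>b\<close> whose partner ends at a vertex. The partners
      of the latter become inputs.\<close>
    define T where "T = P \<union> {r} \<union> {a \<in> arcs G. a \<notin> darcs G \<and> dag G a \<in> darcs G \<and> a \<noteq> b}"
    have PF: "p \<in> darcs G" "dag G p \<in> darcs G" "p \<in> arcs G" "dag G p \<notin> P" if "p \<in> P" for p
    proof -
      have "p \<in> F" using that P(1) by blast
      then show "p \<in> darcs G" "dag G p \<in> darcs G" "p \<in> arcs G" "dag G p \<notin> P"
        using P(2)[of p] that Gd(7)[of p] by (simp_all add: F_def)
    qed
    have T: "T \<subseteq> arcs G" using PF(3) r by (auto simp: T_def)
    have "dag G a \<notin> T" if a: "a \<in> T" for a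
    proof
      assume da: "dag G a \<in> T"
      have inv: "dag G (dag G a) = a" using a T Gd(5) by blast
      from a consider "a \<in> P" | "a = r" | "a \<notin> darcs G" "dag G a \<in> darcs G" "a \<noteq> b"
        unfolding T_def by blast
      then show False
      proof cases
        case 1
        then have "dag G a = r" using da PF[OF 1] unfolding T_def by blast
        then show False using inv r(2) b(2) PF(1)[OF 1] by simp
      next
        case 2
        then show False using da r PF(1)[of b] b(2) unfolding T_def by auto
      next
        case 3
        then have "dag G a = r" using da PF(2)[of "dag G a"] inv unfolding T_def by auto
        then show False using inv r(2) 3(3) by simp
      qed
    qed
    then have "T \<inter> dag G ` T = {}" by blast
    then obtain x where x: "orientation G x" "\<And>a. a \<in> T \<Longrightarrow> x a = 1"
      using orientation_exists[OF G T] by blast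
    have x_dag: "x a = -1" if "a \<in> arcs G" "dag G a \<in> T" for a
      using orientationD(2)[OF x(1), of a] x(2) that by simp
    \<comment> \<open>Any other arc at a vertex has its partner in \<open>T\<close> and therefore
      sign \<open>-1\<close>.\<close>
    have out: "d \<in> P \<or> d = r" if d: "d \<in> darcs G" "x d = 1" for d
    proof (rule ccontr)
      assume not: "\<not> (d \<in> P \<or> d = r)"
      have "dag G d \<in> T"
      proof (cases "dag G d \<in> darcs G")
        case True
        then show ?thesis using P(2)[of d] not d by (auto simp: T_def F_def)
      next
        case False
        then show ?thesis using not d Gd by (auto simp: T_def r_def)
      qed
      then show False using x_dag Gd(7) d by fastforce
    qed
    have "is_singleton (out_arcs (G, x) v)" if v: "v \<in> verts G" for v
    proof (cases "v = v0")
      case v0: True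
      have "out_arcs (G, x) v = {r}"
        using out P(4) x(2)[of r] True unfolding v0
        by (auto simp: out_arcs_def nb_def T_def v0_def) (metis imageI)
      then show ?thesis by simp
    next
      case False
      then obtain p where p: "p \<in> P" "tgt G p = v" using parent v by blast
      have "out_arcs (G, x) v = {p}"
        using out P(3) p PF x(2)[of p] False by (auto simp: out_arcs_def nb_def T_def v0_def) (metis inj_onD)
      then show ?thesis by simp
    qed
    then show ?thesis using x(1) by blast
  qed
qed

section \<open>Elementary graphs\<close>

text \<open>An intrinsic form of being isomorphic to some \<open>star_graph n\<close>, without a
  numbering of the arms: every edge has exactly one end at \<open>v\<close>.\<close>

definition is_star :: "('a, 'v) graph \<Rightarrow> 'v \<Rightarrow> bool" where
  "is_star w v \<longleftrightarrow> graph_data w \<and> \<not> nodeless w \<and> verts w = {v} \<and>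
     arcs w = darcs w \<union> dag w ` darcs w \<and> darcs w \<inter> dag w ` darcs w = {}"

definition is_edge :: "('a, 'v) graph \<Rightarrow> bool" where
  "is_edge w \<longleftrightarrow> graph_data w \<and> \<not> nodeless w \<and> verts w = {} \<and> darcs w = {} \<and>
     (\<exists>a. arcs w = {a, dag w a})"

lemma elementary_cases:
  assumes "elementary w"
  obtains "is_edge w" | v where "is_star w v"
proof -
  have w: "graph_data w" using assms by (simp add: elementary_def)
  note wd = graph_dataD[OF w]
  from assms consider z where "graph_iso w edge_graph z" | n z where "graph_iso w (star_graph n) z"
    unfolding elementary_def isomorphic_def by blast
  then show thesis
  proof cases
    case 1
    have et: "etale w edge_graph z" and b: "bij_betw (fst z) (arcs w) UNIV"
      and bv: "bij_betw (snd z) (verts w) {}" and nl: "\<not> nodeless w"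
      using 1 by (auto simp: graph_iso_def edge_graph_def)
    have v: "verts w = {}" using bv by (auto simp: bij_betw_def)
    obtain a where a: "a \<in> arcs w" "fst z a" using b by (metis (full_types) UNIV_I bij_betw_iff_bijections)
    have da: "\<not> fst z (dag w a)" using et a by (auto simp: etale_def edge_graph_def)
    have "c = a \<or> c = dag w a" if "c \<in> arcs w" for c
      using b a da that wd(4) unfolding bij_betw_def inj_on_def by metis
    then have "arcs w = {a, dag w a}" using a wd(4) by auto
    then have "is_edge w" unfolding is_edge_def using w nl v wd(8) by blast
    then show thesis by (rule that)
  next
    case 2
    have et: "etale w (star_graph n) z" and b: "bij_betw (fst z) (arcs w) ({1..n} \<times> UNIV)"
      and bv: "bij_betw (snd z) (verts w) {()}" and nl: "\<not> nodeless w"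
      using 2 by (auto simp: graph_iso_def star_graph_def)
    obtain v where v: "verts w = {v}"
      using bij_betw_same_card[OF bv] by (auto simp: card_1_singleton_iff)
    have nb: "nb w v = darcs w" using wd(8) v by (auto simp: nb_def)
    have bd: "bij_betw (fst z) (darcs w) ({1..n} \<times> {True})"
    proof -
      have "nb (star_graph n) (snd z v) = {1..n} \<times> {True}" by (auto simp: nb_def star_graph_def)
      then show ?thesis using et v nb by (auto simp: etale_def)
    qed
    have zd: "fst z (dag w a) = (fst (fst z a), \<not> snd (fst z a))" if "a \<in> arcs w" for a
    proof -
      have "fst z a \<in> {1..n} \<times> UNIV" using b that by (auto dest: bij_betwE)
      then show ?thesis using et that by (auto simp: etale_def star_graph_def split: prod.splits)
    qed
    \<comment> \<open>That \<open>z\<close> reflects membership in \<open>darcs\<close> is not a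
      clause of \<open>graph_iso\<close>; it follows from the local bijection at the only
      vertex.\<close>
    have mem: "a \<in> darcs w \<longleftrightarrow> snd (fst z a)" if "a \<in> arcs w" for a
    proof
      assume "a \<in> darcs w"
      then have "fst z a \<in> {1..n} \<times> {True}" using bij_betwE[OF bd] by blast
      then show "snd (fst z a)" by auto
    next
      assume "snd (fst z a)"
      then have "fst z a \<in> {1..n} \<times> {True}" using bij_betwE[OF b] that by (cases "fst z a") auto
      then have "fst z a \<in> fst z ` darcs w" using bij_betw_imp_surj_on[OF bd] by simp
      then obtain a' where "a' \<in> darcs w" "fst z a = fst z a'" by blast
      then show "a \<in> darcs w" using inj_onD[OF bij_betw_imp_inj_on[OF b], of a a'] that wd(7) by simp
    qed
    have "arcs w \<subseteq> darcs w \<union> dag w ` darcs w"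
    proof
      fix a assume a: "a \<in> arcs w"
      show "a \<in> darcs w \<union> dag w ` darcs w"
      proof (cases "a \<in> darcs w")
        case False
        then have "dag w a \<in> darcs w" using mem[OF a] mem[OF wd(4)[OF a]] zd[OF a] by simp
        then have "dag w (dag w a) \<in> dag w ` darcs w" by (rule imageI)
        then show ?thesis using wd(5)[OF a] by simp
      qed simp
    qed
    moreover have "darcs w \<union> dag w ` darcs w \<subseteq> arcs w" using wd(4,7) by blast
    moreover have "darcs w \<inter> dag w ` darcs w = {}"
    proof -
      have "dag w a \<notin> darcs w" if "a \<in> darcs w" for a
        using that mem[of a] mem[of "dag w a"] zd[of a] wd(4)[of a] wd(7)[of a] by simp
      then show ?thesis by blast
    qed
    ultimately have "is_star w v" using w nl v by (auto simp: is_star_def)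
    then show thesis by (rule that)
  qed
qed

lemma is_star_nb: "is_star w v \<Longrightarrow> nb w v = darcs w"
  by (auto simp: is_star_def nb_def dest: graph_dataD(8))

lemma is_star_boundary: "is_star w v \<Longrightarrow> boundary w = dag w ` darcs w"
  by (auto simp: is_star_def boundary_def)

lemma is_edge_connected: "is_edge w \<Longrightarrow> connected_graph w"
  unfolding is_edge_def connected_graph_def
proof (elim conjE exE, intro conjI notI, goal_cases)
  case (1 a)
  then show ?case by simp
next
  case (2 a)
  then obtain A A' V V' where sub: "subgraph_data w A V" "subgraph_data w A' V'"
    and split: "A \<union> A' = arcs w" "A \<inter> A' = {}" "V \<union> V' = verts w"
    and ne: "A \<noteq> {} \<or> V \<noteq> {}" "A' \<noteq> {} \<or> V' \<noteq> {}" by blast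
  have dag: "dag w (dag w a) = a" using graph_dataD(5)[OF 2(1), of a] 2(5) by simp
  have all: "a \<in> B" if B: "subgraph_data w B X" "B \<noteq> {}" for B X
  proof -
    obtain c where c: "c \<in> B" using B(2) by blast
    then have "c = a \<or> c = dag w a" "dag w c \<in> B" using B(1) 2(5) unfolding subgraph_data_def by blast+
    then show ?thesis using c dag by auto
  qed
  have "A \<noteq> {}" "A' \<noteq> {}" using ne split(3) 2(3) by auto
  then show False using all[OF sub(1)] all[OF sub(2)] split(2) by blast
qed

text \<open>A piece containing an arc contains the whole edge and hence \<open>v\<close>, so two
  nonempty pieces would share \<open>v\<close>.\<close>

lemma is_star_connected:
  assumes "is_star w v" shows "connected_graph w"
  unfolding connected_graph_def
proof (intro conjI notI, goal_cases)
  case 1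
  then show ?case using assms by (simp add: is_star_def)
next
  case 2
  then obtain A A' V V' where sub: "subgraph_data w A V" "subgraph_data w A' V'"
    and split: "A \<union> A' = arcs w" "A \<inter> A' = {}" "V \<union> V' = verts w" "V \<inter> V' = {}"
    and ne: "A \<noteq> {} \<or> V \<noteq> {}" "A' \<noteq> {} \<or> V' \<noteq> {}" by blast
  have w: "graph_data w" "verts w = {v}" "arcs w = darcs w \<union> dag w ` darcs w"
    using assms by (auto simp: is_star_def)
  note wd = graph_dataD[OF w(1)]
  have in_V: "v \<in> X" if X: "subgraph_data w B X" "a \<in> B" for B X a
  proof -
    have "a \<in> arcs w" using X by (auto simp: subgraph_data_def)
    then obtain d where d: "d \<in> darcs w" "a = d \<or> a = dag w d" using w(3) by blast
    then have "d \<in> B" using X wd(5,7)[of d] by (auto simp: subgraph_data_def)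
    then have "tgt w d \<in> X" using X(1) d(1) by (auto simp: subgraph_data_def)
    then show ?thesis using wd(8)[OF d(1)] w(2) by simp
  qed
  have "v \<in> V" using in_V[OF sub(1)] ne(1) split(3) w(2) by (cases "A = {}") auto
  moreover have "v \<in> V'" using in_V[OF sub(2)] ne(2) split(3) w(2) by (cases "A' = {}") auto
  ultimately show False using split(4) by blast
qed

text \<open>Every arc of a cycle lies in \<open>darcs\<close> together with its partner, whereas
  elementary graphs have no internal edges.\<close>

lemma elementary_is_tree:
  assumes "elementary w" shows "is_tree w"
proof -
  have "as \<noteq> [] \<Longrightarrow> as ! 0 \<in> darcs w \<and> dag w (as ! 0) \<in> darcs w" if "is_cycle w as" for as
    using that by (auto simp: is_cycle_def)
  moreover have "as \<noteq> []" if "is_cycle w as" for as using that by (simp add: is_cycle_def)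
  ultimately have cyc: "\<not> is_cycle w as" if "darcs w \<inter> dag w ` darcs w = {}" for as
    using that by blast
  from assms show ?thesis
  proof (cases rule: elementary_cases)
    case 1
    then show ?thesis using is_edge_connected[OF 1] cyc
      by (auto simp: is_tree_def is_graph_def is_edge_def)
  next
    case (2 v)
    then show ?thesis using is_star_connected[OF 2] cyc
      by (auto simp: is_tree_def is_graph_def is_star_def)
  qed
qed

lemma is_tree_conn_graphs: "is_tree G \<Longrightarrow> G \<in> conn_graphs"
  by (simp add: is_tree_def conn_graphs_def)

lemma conn_graphsD:
  assumes "G \<in> conn_graphs"
  shows "graph_data G" "connected_graph G" "\<not> nodeless G"
  using assms by (simp_all add: conn_graphs_def is_graph_def)

lemma conn_graphs_not_nodeless_loop: "G \<in> conn_graphs \<Longrightarrow> \<not> is_nodeless_loop G"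
  by (simp add: conn_graphs_def is_graph_def is_nodeless_loop_def)

section \<open>Classes of embeddings\<close>

lemma etaleD:
  assumes "etale H G f"
  shows "fst f \<in> extensional (arcs H)" "snd f \<in> extensional (verts H)"
    "\<And>a. a \<in> arcs H \<Longrightarrow> fst f a \<in> arcs G" "\<And>v. v \<in> verts H \<Longrightarrow> snd f v \<in> verts G"
    "\<And>a. a \<in> arcs H \<Longrightarrow> fst f (dag H a) = dag G (fst f a)"
    "\<And>d. d \<in> darcs H \<Longrightarrow> fst f d \<in> darcs G"
    "\<And>d. d \<in> darcs H \<Longrightarrow> tgt G (fst f d) = snd f (tgt H d)"
    "\<And>v. v \<in> verts H \<Longrightarrow> bij_betw (fst f) (nb H v) (nb G (snd f v))"
  using assms by (auto simp: etale_def PiE_def)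

lemma etale_comp:
  assumes H: "graph_data H" and f: "etale H K f" and g: "etale K G g"
  shows "etale H G (etale_comp H g f)"
proof -
  note Hd = graph_dataD[OF H] and fd = etaleD[OF f] and gd = etaleD[OF g]
  have nb: "nb H v \<subseteq> arcs H" for v using Hd(7) by (auto simp: nb_def)
  have "bij_betw (compose (arcs H) (fst g) (fst f)) (nb H v) (nb G (snd g (snd f v)))"
    if "v \<in> verts H" for v
  proof -
    have "bij_betw (fst g \<circ> fst f) (nb H v) (nb G (snd g (snd f v)))"
      using bij_betw_trans fd(4,8) gd(8) that by blast
    then show ?thesis
      by (rule bij_betw_cong[THEN iffD1, rotated]) (use nb in \<open>auto simp: compose_def\<close>)
  qed
  then show ?thesis
    using Hd fd gd by (auto simp: etale_def etale_comp_def compose_def)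
qed

lemma etale_etale_id:
  assumes "graph_data G" shows "etale G G (etale_id G)"
proof -
  note Gd = graph_dataD[OF assms]
  have "bij_betw (restrict id (arcs G)) (nb G v) (nb G v)" for v
    by (rule bij_betw_cong[THEN iffD1, rotated, OF bij_betw_id]) (auto simp: nb_def Gd)
  then show ?thesis using Gd by (auto simp: etale_def etale_id_def)
qed

lemma graph_isoD:
  assumes "graph_iso H G z"
  shows "etale H G z" "bij_betw (fst z) (arcs H) (arcs G)" "bij_betw (snd z) (verts H) (verts G)"
    "nodeless H \<longleftrightarrow> nodeless G"
  using assms by (auto simp: graph_iso_def)

lemma graph_iso_id: "graph_data G \<Longrightarrow> graph_iso G G (etale_id G)"
  by (auto simp: graph_iso_def etale_etale_id) (auto simp: etale_id_def bij_betw_def inj_on_def)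

lemma bij_betw_compose: "bij_betw f A B \<Longrightarrow> bij_betw g B C \<Longrightarrow> bij_betw (compose A g f) A C"
  by (auto simp: bij_betw_def inj_on_compose surj_compose)

lemma graph_iso_comp:
  assumes "graph_data H" "graph_iso H K f" "graph_iso K G g"
  shows "graph_iso H G (etale_comp H g f)"
proof -
  have "etale H G (etale_comp H g f)"
    using etale_comp[OF assms(1) graph_isoD(1)[OF assms(2)] graph_isoD(1)[OF assms(3)]] .
  then show ?thesis
    using graph_isoD[OF assms(2)] graph_isoD[OF assms(3)]
    by (simp add: graph_iso_def bij_betw_compose etale_comp_def)
qed

text \<open>Surjectivity on vertices and the bijections between the sets \<open>nb\<close> give
  \<open>fst z a\<close> a preimage in \<open>darcs K\<close>; injectivity on arcs identifies it
  with \<open>a\<close>.\<close>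

lemma graph_iso_darcs:
  assumes K: "graph_data K" and G: "graph_data G" and z: "graph_iso K G z" and a: "a \<in> arcs K"
  shows "fst z a \<in> darcs G \<longleftrightarrow> a \<in> darcs K"
proof
  note zd = graph_isoD[OF z] note e = etaleD[OF zd(1)]
  show "fst z a \<in> darcs G" if "a \<in> darcs K" using e(6) that .
  assume d: "fst z a \<in> darcs G"
  then have "tgt G (fst z a) \<in> verts G" using graph_dataD(8)[OF G] by blast
  then obtain v where v: "v \<in> verts K" "snd z v = tgt G (fst z a)"
    using zd(3) by (metis bij_betw_def imageE)
  then have "fst z a \<in> nb G (snd z v)" using d by (simp add: nb_def)
  then obtain a' where "a' \<in> nb K v" "fst z a' = fst z a"
    using e(8)[OF v(1)] by (metis bij_betw_def imageE)
  then have a': "a' \<in> darcs K" "fst z a' = fst z a" by (simp_all add: nb_def)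
  then have "a' = a" using zd(2) a graph_dataD(7)[OF K] by (metis bij_betw_def inj_onD)
  then show "a \<in> darcs K" using a' by simp
qed

lemma graph_iso_boundary:
  assumes K: "graph_data K" and G: "graph_data G" and z: "graph_iso K G z"
  shows "fst z ` boundary K = boundary G"
proof -
  note zd = graph_isoD[OF z]
  have "fst z ` (arcs K - darcs K) = arcs G - darcs G"
  proof
    show "fst z ` (arcs K - darcs K) \<subseteq> arcs G - darcs G"
      using graph_iso_darcs[OF K G z] bij_betwE[OF zd(2)] by blast
    show "arcs G - darcs G \<subseteq> fst z ` (arcs K - darcs K)"
    proof
      fix b assume b: "b \<in> arcs G - darcs G"
      then have "b \<in> fst z ` arcs K" using bij_betw_imp_surj_on[OF zd(2)] by simp
      then obtain a where "a \<in> arcs K" "b = fst z a" by blast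
      then show "b \<in> fst z ` (arcs K - darcs K)" using graph_iso_darcs[OF K G z, of a] b by blast
    qed
  qed
  then show ?thesis using zd(4) by (simp add: boundary_def)
qed

lemma graph_iso_inverse:
  assumes K: "graph_data K" and G: "graph_data G" and z: "graph_iso K G z"
  obtains y where "graph_iso G K y"
    "\<And>a. a \<in> arcs G \<Longrightarrow> fst z (fst y a) = a" "\<And>v. v \<in> verts G \<Longrightarrow> snd z (snd y v) = v"
proof -
  note zd = graph_isoD[OF z] note e = etaleD[OF zd(1)] and Kd = graph_dataD[OF K] and Gd = graph_dataD[OF G]
  define y0 y1 where "y0 = inv_into (arcs K) (fst z)" and "y1 = inv_into (verts K) (snd z)"
  have y0: "y0 a \<in> arcs K" "fst z (y0 a) = a" if "a \<in> arcs G" for a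
    using zd(2) that by (auto simp: y0_def bij_betw_def inv_into_into f_inv_into_f)
  have y1: "y1 v \<in> verts K" "snd z (y1 v) = v" if "v \<in> verts G" for v
    using zd(3) that by (auto simp: y1_def bij_betw_def inv_into_into f_inv_into_f)
  have y0z: "y0 (fst z a) = a" if "a \<in> arcs K" for a
    using zd(2) that by (simp add: y0_def bij_betw_def)
  have y1z: "y1 (snd z v) = v" if "v \<in> verts K" for v
    using zd(3) that by (simp add: y1_def bij_betw_def)
  have y0b: "bij_betw y0 (arcs G) (arcs K)" unfolding y0_def using zd(2) by (rule bij_betw_inv_into)
  have y1b: "bij_betw y1 (verts G) (verts K)" unfolding y1_def using zd(3) by (rule bij_betw_inv_into)
  have ydag: "y0 (dag G a) = dag K (y0 a)" if "a \<in> arcs G" for a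
    using e(5)[OF y0(1)[OF that]] y0[OF that] y0z Kd(4) by metis
  have ydarcs: "y0 a \<in> darcs K" if "a \<in> darcs G" for a
    using graph_iso_darcs[OF K G z y0(1)[OF Gd(7)[OF that]]] y0(2)[OF Gd(7)[OF that]] that by simp
  have ytgt: "tgt K (y0 a) = y1 (tgt G a)" if "a \<in> darcs G" for a
    using e(7)[OF ydarcs[OF that]] y0(2)[OF Gd(7)[OF that]] y1z[OF Kd(8)[OF ydarcs[OF that]]] by simp
  have ynb: "bij_betw y0 (nb G v) (nb K (y1 v))" if v: "v \<in> verts G" for v
  proof (rule bij_betw_imageI)
    show "inj_on y0 (nb G v)"
      using y0b Gd(7) by (auto simp: bij_betw_def nb_def inj_on_def)
    show "y0 ` nb G v = nb K (y1 v)"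
    proof
      show "y0 ` nb G v \<subseteq> nb K (y1 v)" using ydarcs ytgt by (auto simp: nb_def)
      show "nb K (y1 v) \<subseteq> y0 ` nb G v"
      proof
        fix a assume a: "a \<in> nb K (y1 v)"
        then have "fst z a \<in> nb G v" using e(6,7) y1(2)[OF v] by (auto simp: nb_def)
        moreover have "y0 (fst z a) = a" using y0z Kd(7) a by (auto simp: nb_def)
        ultimately show "a \<in> y0 ` nb G v" by (metis imageI)
      qed
    qed
  qed
  define y where "y = (restrict y0 (arcs G), restrict y1 (verts G))"
  have "bij_betw (fst y) (nb G v) (nb K (snd y v))" if v: "v \<in> verts G" for v
  proof -
    have "bij_betw (restrict y0 (arcs G)) (nb G v) (nb K (y1 v))"
      using ynb[OF v] by (rule bij_betw_cong[THEN iffD1, rotated]) (auto simp: nb_def Gd)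
    then show ?thesis using v by (simp add: y_def)
  qed
  then have "etale G K y"
    unfolding etale_def using y0(1) y1(1) ydag ydarcs ytgt Gd(4,7,8) by (auto simp: y_def)
  then have "graph_iso G K y"
    unfolding graph_iso_def using y0b y1b zd(4) by (simp add: y_def bij_betw_restrict_eq)
  then show thesis using y0 y1 by (intro that[of y]) (auto simp: y_def)
qed

lemma embeddingD:
  assumes "embedding H G f"
  shows "graph_data H" "graph_data G" "etale H G f" "inj_on (snd f) (verts H)"
  using assms
  by (auto simp: embedding_def conn_graphs_def is_graph_def nodeless_loops_def is_nodeless_loop_def)

text \<open>\<open>K\<close> and \<open>H\<close> may have other types than \<open>G\<close>. This
  is how \<open>star_at\<close>, whose arcs lie in a sum type, is compared with stars over the arc
  type of \<open>G\<close>.\<close>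

lemma emb_class_iso:
  fixes G :: "('a, 'v) graph" and K :: "('b, 'w) graph" and H :: "('c, 'u) graph"
  assumes K: "graph_data K" and H: "graph_data H" and z: "graph_iso K H z"
    and g: "g = etale_comp K f z"
  shows "emb_class G K g = emb_class G H f"
proof -
  note zd = graph_isoD[OF z]
  obtain y where y: "graph_iso H K y" "\<And>a. a \<in> arcs H \<Longrightarrow> fst z (fst y a) = a"
    "\<And>v. v \<in> verts H \<Longrightarrow> snd z (snd y v) = v"
    using graph_iso_inverse[OF K H z] by blast
  have 1: "\<exists>z2. graph_iso H' H z2 \<and> f' = etale_comp H' f z2"
    if "graph_data H'" "graph_iso H' K z1" "f' = etale_comp H' g z1" for H' :: "('a, 'v) graph" and f' z1
  proof (intro exI conjI)
    show "graph_iso H' H (etale_comp H' z z1)" using graph_iso_comp that(1,2) z by blast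
    show "f' = etale_comp H' f (etale_comp H' z z1)"
      using etaleD(3,4)[OF graph_isoD(1)[OF that(2)]]
      unfolding that(3) g by (auto simp: etale_comp_def compose_def fun_eq_iff)
  qed
  have 2: "\<exists>z2. graph_iso H' K z2 \<and> f' = etale_comp H' g z2"
    if "graph_data H'" "graph_iso H' H z1" "f' = etale_comp H' f z1" for H' :: "('a, 'v) graph" and f' z1
  proof (intro exI conjI)
    show "graph_iso H' K (etale_comp H' y z1)" using graph_iso_comp that(1,2) y(1) by blast
    show "f' = etale_comp H' g (etale_comp H' y z1)"
      using etaleD(3,4)[OF graph_isoD(1)[OF that(2)]] etaleD(3,4)[OF graph_isoD(1)[OF y(1)]] y(2,3)
      unfolding that(3) g by (auto simp: etale_comp_def compose_def fun_eq_iff)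
  qed
  have "(H', f') \<in> emb_class G K g \<longleftrightarrow> (H', f') \<in> emb_class G H f" for H' f'
    unfolding emb_class_def mem_Collect_eq prod.case using 1 2 embeddingD(1) by blast
  then show ?thesis by auto
qed

lemma etale_comp_id:
  assumes "etale H G f" shows "etale_comp H f (etale_id H) = f"
proof (rule prod_eqI)
  note e = etaleD[OF assms]
  show "fst (etale_comp H f (etale_id H)) = fst f"
    by (rule extensionalityI[OF _ e(1)]) (simp_all add: etale_comp_def etale_id_def compose_def)
  show "snd (etale_comp H f (etale_id H)) = snd f"
    by (rule extensionalityI[OF _ e(2)]) (simp_all add: etale_comp_def etale_id_def compose_def)
qed

lemma emb_class_self:
  assumes "embedding H G f" shows "(H, f) \<in> emb_class G H f"
  unfolding emb_class_def mem_Collect_eq prod.case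
  using assms graph_iso_id[OF embeddingD(1)[OF assms]] etale_comp_id[OF embeddingD(3)[OF assms]]
  by (intro conjI exI[of _ "etale_id H"]) simp_all

lemma emb_class_member:
  assumes "embedding H G f" and "(H', f') \<in> emb_class G H f"
  shows "snd f' ` verts H' = snd f ` verts H" "fst f' ` boundary H' = fst f ` boundary H"
proof -
  obtain z where z: "graph_iso H' H z" "f' = etale_comp H' f z" and H': "graph_data H'"
    using assms(2) by (auto simp: emb_class_def dest: embeddingD(1))
  have "snd f' ` verts H' = (\<lambda>v. snd f (snd z v)) ` verts H'"
    unfolding z(2) by (intro image_cong refl) (simp add: etale_comp_def compose_def)
  also have "\<dots> = snd f ` verts H"
    using bij_betw_imp_surj_on[OF graph_isoD(3)[OF z(1)]] by (simp add: image_image[symmetric])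
  finally show "snd f' ` verts H' = snd f ` verts H" .
  have "fst z ` boundary H' = boundary H"
    by (rule graph_iso_boundary[OF H' embeddingD(1)[OF assms(1)] z(1)])
  moreover have "a \<in> arcs H'" if "a \<in> boundary H'" for a
    using that by (simp add: boundary_def split: if_splits)
  then have "fst f' ` boundary H' = (\<lambda>a. fst f (fst z a)) ` boundary H'"
    unfolding z(2) by (intro image_cong refl) (simp add: etale_comp_def compose_def)
  then have "fst f' ` boundary H' = fst f ` fst z ` boundary H'" by (simp add: image_image)
  ultimately show "fst f' ` boundary H' = fst f ` boundary H" by simp
qed

text \<open>\<open>H\<close> has the types of \<open>G\<close>, so the class contains the pair
  \<open>(H, f)\<close> itself; for an empty class the union would be empty.\<close>

lemma emb_verts_class:
  fixes G H :: "('a, 'v) graph"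
  assumes "embedding H G f" shows "emb_verts (emb_class G H f) = snd f ` verts H"
proof -
  have "(case p of (H', f') \<Rightarrow> snd f' ` verts H') = snd f ` verts H" if "p \<in> emb_class G H f" for p
    using emb_class_member(1)[OF assms, of "fst p" "snd p"] that by (simp add: case_prod_unfold)
  then have "emb_verts (emb_class G H f) = (\<Union>p\<in>emb_class G H f. snd f ` verts H)"
    unfolding emb_verts_def by (rule SUP_cong[OF refl])
  then show ?thesis using emb_class_self[OF assms] by auto
qed

lemma emb_boundary_class:
  fixes G H :: "('a, 'v) graph"
  assumes "embedding H G f" shows "emb_boundary (emb_class G H f) = fst f ` boundary H"
proof -
  have "(case p of (H', f') \<Rightarrow> fst f' ` boundary H') = fst f ` boundary H" if "p \<in> emb_class G H f" for p
    using emb_class_member(2)[OF assms, of "fst p" "snd p"] that by (simp add: case_prod_unfold)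
  then have "emb_boundary (emb_class G H f) = (\<Union>p\<in>emb_class G H f. fst f ` boundary H)"
    unfolding emb_boundary_def by (rule SUP_cong[OF refl])
  then show ?thesis using emb_class_self[OF assms] by auto
qed

section \<open>Embedded stars and their classes\<close>

lemma star_embedding_bij:
  assumes "is_star w v" "embedding w c f"
  shows "bij_betw (fst f) (darcs w) (nb c (snd f v))"
  using etaleD(8)[OF embeddingD(3)[OF assms(2)]] is_star_nb[OF assms(1)] assms(1)
  by (auto simp: is_star_def)

text \<open>A star embedded with its vertex at \<open>u\<close> is a copy of \<open>star_at c u\<close> over \<open>c\<close>.\<close>

lemma iota_class_star:
  assumes star: "is_star w v" and f: "embedding w c f"
  shows "iota_class c (snd f v) = emb_class c w f"
proof -
  define u where "u = snd f v"
  have w: "graph_data w" "verts w = {v}" "arcs w = darcs w \<union> dag w ` darcs w"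
    "darcs w \<inter> dag w ` darcs w = {}" "\<not> nodeless w"
    using star by (auto simp: is_star_def)
  note wd = graph_dataD[OF w(1)] and cd = graph_dataD[OF embeddingD(2)[OF f]]
    and fd = etaleD[OF embeddingD(3)[OF f]]
  have bij: "bij_betw (fst f) (darcs w) (nb c u)"
    unfolding u_def by (rule star_embedding_bij[OF star f])
  have fin: "fst f d \<in> nb c u" if "d \<in> darcs w" for d using bij that by (rule bij_betw_apply)
  have surj: "\<exists>d\<in>darcs w. fst f d = b" if "b \<in> nb c u" for b
  proof -
    have "b \<in> fst f ` darcs w" using that bij_betw_imp_surj_on[OF bij] by simp
    then show ?thesis by auto
  qed
  have inj: "d = d'" if "fst f d = fst f d'" "d \<in> darcs w" "d' \<in> darcs w" for d d'
    using bij that by (auto simp: bij_betw_def inj_on_def)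
  have ndag: "dag w d \<notin> darcs w" if "d \<in> darcs w" for d using that w(4) by blast
  \<comment> \<open>In \<open>star_at\<close> the outer arc of an arm is named after the inner one.
    As \<open>f\<close> commutes with \<open>dag\<close>, applying \<open>dag c\<close> to the image
    of an outer arc recovers that name.\<close>
  define z where "z = (\<lambda>a\<in>arcs w. if a \<in> darcs w then Inl (fst f a) else Inr (dag c (fst f a)),
      \<lambda>a\<in>verts w. u)"
  have zd: "fst z d = Inl (fst f d)" if "d \<in> darcs w" for d
    using that wd(7) by (simp add: z_def)
  have zdd: "fst z (dag w d) = Inr (fst f d)" if "d \<in> darcs w" for d
    using ndag[OF that] wd(4)[OF wd(7)[OF that]] fd(5)[OF wd(7)[OF that]] cd(5)[OF fd(3)[OF wd(7)[OF that]]]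
    by (simp add: z_def)
  have zv: "snd z v = u" "snd z \<in> extensional (verts w)" "fst z \<in> extensional (arcs w)"
    by (simp_all add: z_def w(2))
  have arc_cases: thesis if "a \<in> arcs w" "a \<in> darcs w \<Longrightarrow> thesis"
    "\<And>d. d \<in> darcs w \<Longrightarrow> a = dag w d \<Longrightarrow> thesis" for a thesis
    using that w(3) by blast
  have inj_z: "inj_on (fst z) (arcs w)"
  proof (rule inj_onI)
    fix a b assume "a \<in> arcs w" "b \<in> arcs w" "fst z a = fst z b"
    then show "a = b"
      by (elim arc_cases) (auto simp: zd zdd dest: inj)
  qed
  have img_z: "fst z ` arcs w = arcs (star_at c u)"
  proof
    show "fst z ` arcs w \<subseteq> arcs (star_at c u)"
      using fin by (auto simp: star_at_def zd zdd elim!: arc_cases)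
    show "arcs (star_at c u) \<subseteq> fst z ` arcs w"
    proof
      fix b assume "b \<in> arcs (star_at c u)"
      then obtain n where n: "n \<in> nb c u" "b = Inl n \<or> b = Inr n" by (auto simp: star_at_def)
      obtain d where d: "d \<in> darcs w" "fst f d = n" using surj[OF n(1)] by blast
      have "fst z d = Inl n" "fst z (dag w d) = Inr n" using zd zdd d by auto
      then show "b \<in> fst z ` arcs w" using n(2) d(1) wd(4,7) by (metis imageI)
    qed
  qed
  have nb_star: "nb (star_at c u) u = Inl ` nb c u"
    by (auto simp: nb_def star_at_def)
  have data: "graph_data (star_at c u)"
    using cd(1) by (auto simp: graph_data_def star_at_def nb_def dest: cd(7) intro: finite_subset)
  have "etale w (star_at c u) z"
    unfolding etale_def
  proof (intro conjI ballI)
    show "fst z \<in> arcs w \<rightarrow>\<^sub>E arcs (star_at c u)" using img_z zv(3) by (auto simp: PiE_def)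
    show "snd z \<in> verts w \<rightarrow>\<^sub>E verts (star_at c u)"
      by (simp add: z_def w(2) star_at_def)
    show "fst z (dag w a) = dag (star_at c u) (fst z a)" if "a \<in> arcs w" for a
      using that fin by (elim arc_cases) (auto simp: zd zdd star_at_def wd(5,7))
    show "fst z d \<in> darcs (star_at c u)" "tgt (star_at c u) (fst z d) = snd z (tgt w d)"
      if d: "d \<in> darcs w" for d
      using fin[OF d] wd(8)[OF d] by (auto simp: zd[OF d] star_at_def w(2) zv)
    fix v' assume "v' \<in> verts w"
    then have v': "v' = v" using w(2) by simp
    have "bij_betw (fst z) (darcs w) (Inl ` nb c u)"
      unfolding bij_betw_def
    proof
      show "inj_on (fst z) (darcs w)" using inj_z wd(7) by (auto simp: inj_on_def)
      have "fst z ` darcs w = Inl ` fst f ` darcs w" using zd by force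
      then show "fst z ` darcs w = Inl ` nb c u" using bij by (simp add: bij_betw_def)
    qed
    then show "bij_betw (fst z) (nb w v') (nb (star_at c u) (snd z v'))"
      unfolding v' zv(1) nb_star is_star_nb[OF star] .
  qed
  then have iso: "graph_iso w (star_at c u) z"
    unfolding graph_iso_def using inj_z img_z w(2,5) zv(1)
    by (auto simp: bij_betw_def star_at_def)
  have "f = etale_comp w (iota c u) z"
  proof (rule prod_eqI)
    show "fst f = fst (etale_comp w (iota c u) z)"
    proof (rule extensionalityI[OF fd(1)])
      fix a assume a: "a \<in> arcs w"
      then have "fst z a \<in> arcs (star_at c u)" using img_z by blast
      then show "fst f a = fst (etale_comp w (iota c u) z) a"
        using a by (elim arc_cases)
          (auto simp: etale_comp_def compose_def iota_def zd zdd fd(5) wd(4,7))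
    qed (simp add: etale_comp_def)
    show "snd f = snd (etale_comp w (iota c u) z)"
      by (rule extensionalityI[OF fd(2)])
        (auto simp: etale_comp_def compose_def iota_def zv w(2) star_at_def u_def)
  qed
  then show ?thesis
    unfolding iota_class_def u_def[symmetric]
    using emb_class_iso[OF w(1) data iso] by metis
qed

text \<open>This is, for stars, the uniqueness on which the composite of graphical maps relies. A
  representative \<open>K\<close> has one vertex and, being connected, only edges at that vertex;
  the boundary condition excludes loops, so \<open>K\<close> is a star.\<close>

lemma star_class_unique:
  assumes c: "c \<in> conn_graphs" and star: "is_star w v" and f: "embedding w c f"
    and k: "k \<in> Emb c" "emb_boundary k = fst f ` boundary w" "emb_verts k = {snd f v}"
  shows "k = iota_class c (snd f v)"
proof -
  obtain K :: "('a, 'b) graph" and g where kg: "k = emb_class c K g" and g: "embedding K c g"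
    using k(1) by (auto simp: Emb_def)
  have w: "graph_data w" "verts w = {v}" "arcs w = darcs w \<union> dag w ` darcs w"
    "darcs w \<inter> dag w ` darcs w = {}" "\<not> nodeless w"
    using star by (auto simp: is_star_def)
  have bd: "fst g ` boundary K = fst f ` boundary w"
    using k(2) unfolding kg emb_boundary_class[OF g] .
  have "snd g ` verts K = {snd f v}" using k(3) unfolding kg emb_verts_class[OF g] .
  then obtain y where y: "y \<in> verts K" "snd g y = snd f v"
    and all: "\<And>y'. y' \<in> verts K \<Longrightarrow> snd g y' = snd f v" by blast
  have "y' = y" if "y' \<in> verts K" for y'
    using inj_onD[OF embeddingD(4)[OF g], of y' y] all[OF that] that y by simp
  then have vK: "verts K = {y}" using y(1) by blast
  have nlK: "\<not> nodeless K" and Kconn: "connected_graph K"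
    using g c conn_graphsD[OF c] by (auto simp: embedding_def conn_graphs_def is_graph_def
        nodeless_loops_def is_nodeless_loop_def)
  note Kd = graph_dataD[OF embeddingD(1)[OF g]] and wd = graph_dataD[OF w(1)]
    and cd = graph_dataD[OF embeddingD(2)[OF f]]
    and fd = etaleD[OF embeddingD(3)[OF f]] and gd = etaleD[OF embeddingD(3)[OF g]]
  have nbK: "nb K y = darcs K" using Kd(8) vK by (auto simp: nb_def)
  have bijf: "bij_betw (fst f) (darcs w) (nb c (snd f v))" by (rule star_embedding_bij[OF star f])
  have bijg: "bij_betw (fst g) (darcs K) (nb c (snd f v))"
    using gd(8)[OF y(1)] y(2) nbK by simp
  have arcsK: "darcs K \<union> dag K ` darcs K = arcs K"
  proof (rule connected_graph_split(1)[OF Kconn])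
    show "subgraph_data K (darcs K \<union> dag K ` darcs K) {y}"
      using Kd(4,5,7,8) vK by (auto simp: subgraph_data_def)
    have "dag K a \<notin> darcs K \<union> dag K ` darcs K"
      if a: "a \<in> arcs K" "a \<notin> darcs K \<union> dag K ` darcs K" for a
    proof
      assume "dag K a \<in> darcs K \<union> dag K ` darcs K"
      then have "dag K (dag K a) \<in> darcs K \<union> dag K ` darcs K" using Kd(5,7) by auto
      then show False using a Kd(5) by simp
    qed
    then show "subgraph_data K (arcs K - (darcs K \<union> dag K ` darcs K)) (verts K - {y})"
      using Kd(4) by (auto simp: subgraph_data_def)
  qed simp
  \<comment> \<open>Suppose \<open>d\<close> lies on a loop, and let \<open>e\<close> be the arc of
    the star over the same arc of \<open>c\<close>. The outer arc \<open>dag w e\<close> has the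
    same image as a boundary arc of \<open>K\<close>, which is the partner of some \<open>d'\<close>
    at the vertex. Local injectivity gives \<open>d' = d\<close>, so this boundary arc would lie in
    \<open>darcs K\<close>.\<close>
  have "dag K d \<notin> darcs K" if d: "d \<in> darcs K" for d
  proof
    assume dd: "dag K d \<in> darcs K"
    have "fst g d \<in> fst f ` darcs w"
      using bij_betw_apply[OF bijg d] bij_betw_imp_surj_on[OF bijf] by simp
    then obtain e where e: "e \<in> darcs w" "fst g d = fst f e" by blast
    have "dag w e \<in> boundary w" using e(1) is_star_boundary[OF star] by simp
    then have "fst f (dag w e) \<in> fst g ` boundary K" using bd by blast
    then obtain b where b: "b \<in> boundary K" "fst f (dag w e) = fst g b" by blast
    have b': "b \<in> arcs K" "b \<notin> darcs K" using b(1) nlK by (auto simp: boundary_def)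
    then obtain d' where d': "d' \<in> darcs K" "b = dag K d'" using arcsK by blast
    have "dag c (fst g d') = dag c (fst f e)"
      using b(2) d'(2) fd(5)[OF wd(7)[OF e(1)]] gd(5)[OF Kd(7)[OF d'(1)]] by simp
    then have "fst g d' = fst g d"
      using e cd(5)[OF fd(3)[OF wd(7)[OF e(1)]]] cd(5)[OF gd(3)[OF Kd(7)[OF d'(1)]]] by metis
    then have "d' = d" using bijg d d'(1) by (auto simp: bij_betw_def inj_on_def)
    then show False using b'(2) d'(2) dd by simp
  qed
  then have "is_star K y"
    unfolding is_star_def using embeddingD(1)[OF g] nlK vK arcsK by blast
  then show ?thesis using iota_class_star[OF _ g] y(2) kg by metis
qed

section \<open>Identities of elementary graphs and images of inert maps\<close>

lemma embedding_id:
  assumes "G \<in> conn_graphs" shows "embedding G G (etale_id G)"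
  using assms etale_etale_id[OF conn_graphsD(1)[OF assms]]
  by (auto simp: embedding_def etale_id_def inj_on_def)

lemma iota_class_self: "is_star w v \<Longrightarrow> w \<in> conn_graphs \<Longrightarrow> iota_class w v = emb_class w w (etale_id w)"
  using iota_class_star[OF _ embedding_id, of w v] by (simp add: etale_id_def is_star_def)

text \<open>As \<open>gcomp\<close> uses \<open>THE\<close>, this unit law is a statement of
  existence and uniqueness. An edge has no vertex at which to evaluate; on a star,
  \<open>star_class_unique\<close> identifies the described class with that of
  \<open>f\<close>.\<close>

lemma gcomp_gid:
  assumes c: "c \<in> conn_graphs" and w: "elementary w" and f: "embedding w c f"
  shows "gcomp w c (gmap_of w c f) (gid w) = gmap_of w c f"
proof (rule prod_eqI)
  note fd = etaleD[OF embeddingD(3)[OF f]]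
  show "fst (gcomp w c (gmap_of w c f) (gid w)) = fst (gmap_of w c f)"
    using fd(1) by (auto simp: gcomp_def gmap_of_def gid_def etale_id_def compose_def extensional_def)
  have wc: "w \<in> conn_graphs" using w by (intro is_tree_conn_graphs elementary_is_tree)
  show "snd (gcomp w c (gmap_of w c f) (gid w)) = snd (gmap_of w c f)"
    using w
  proof (cases rule: elementary_cases)
    case 1
    then show ?thesis by (simp add: gcomp_def gmap_of_def is_edge_def restrict_def)
  next
    case (2 v)
    have v: "verts w = {v}" using 2 by (simp add: is_star_def)
    have id: "snd (gid w) v = emb_class w w (etale_id w)"
      using iota_class_self[OF 2 wc] by (simp add: gid_def gmap_of_def v etale_id_def)
    have idv: "emb_verts (snd (gid w) v) = {v}"
      unfolding id emb_verts_class[OF embedding_id[OF wc]] by (simp add: etale_id_def v)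
    have "boundary w \<subseteq> arcs w" by (auto simp: boundary_def)
    then have idb: "emb_boundary (snd (gid w) v) = boundary w"
      unfolding id emb_boundary_class[OF embedding_id[OF wc]] by (force simp: etale_id_def)
    have cls: "iota_class c (snd f v) = emb_class c w f" by (rule iota_class_star[OF 2 f])
    have fv: "snd (gmap_of w c f) v = iota_class c (snd f v)" by (simp add: gmap_of_def v)
    have "(THE k. k \<in> Emb c \<and> emb_boundary k = fst (gmap_of w c f) ` emb_boundary (snd (gid w) v) \<and>
        emb_verts k = (\<Union>w'\<in>emb_verts (snd (gid w) v). emb_verts (snd (gmap_of w c f) w'))) =
        iota_class c (snd f v)" (is "(THE k. ?P k) = _")
    proof (rule the_equality)
      have "emb_class c w f \<in> Emb c" unfolding Emb_def using f by blast
      then show "?P (iota_class c (snd f v))"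
        unfolding idv idb fv cls using emb_boundary_class[OF f] emb_verts_class[OF f]
        by (simp add: fv cls) (simp add: gmap_of_def)
      fix k assume "?P k"
      then show "k = iota_class c (snd f v)"
        unfolding idv idb using emb_verts_class[OF f] v
        by (intro star_class_unique[OF c 2 f]) (simp_all add: fv cls, simp add: gmap_of_def)
    qed
    then have "snd (gcomp w c (gmap_of w c f) (gid w)) v = snd (gmap_of w c f) v"
      unfolding fv gcomp_def snd_conv v by simp
    then show ?thesis
      by (intro extensionalityI[where A = "{v}"]) (simp_all add: gcomp_def gmap_of_def v)
  qed
qed

lemma gid_hom_U:
  assumes w: "elementary w" shows "gid w \<in> hom_U w w"
proof -
  have wc: "w \<in> conn_graphs" using w by (intro is_tree_conn_graphs elementary_is_tree)
  note wd = graph_dataD[OF conn_graphsD(1)[OF wc]]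
  have arcs: "fst (gid w) \<in> arcs w \<rightarrow>\<^sub>E arcs w" "\<forall>a\<in>arcs w. fst (gid w) (dag w a) = dag w (fst (gid w) a)"
    using wd by (auto simp: gid_def gmap_of_def etale_id_def)
  from w show ?thesis
  proof (cases rule: elementary_cases)
    case 1
    then show ?thesis using arcs
      by (auto simp: hom_U_def pre_graphical_def gid_def gmap_of_def is_edge_def boundary_def)
  next
    case (2 v)
    have v: "verts w = {v}" using 2 by (simp add: is_star_def)
    have id: "snd (gid w) v = emb_class w w (etale_id w)"
      using iota_class_self[OF 2 wc] by (simp add: gid_def gmap_of_def v etale_id_def)
    have ext: "snd (gid w) \<in> extensional (verts w)" by (simp add: gid_def gmap_of_def)
    have emb: "emb_class w w (etale_id w) \<in> Emb w" unfolding Emb_def using embedding_id[OF wc] by blast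
    have "boundary w \<subseteq> arcs w" by (auto simp: boundary_def)
    then have idb: "emb_boundary (snd (gid w) v) = boundary w"
      unfolding id emb_boundary_class[OF embedding_id[OF wc]] by (force simp: etale_id_def)
    have "bij_betw (dag w) (darcs w) (dag w ` darcs w)"
      using wd(5,7) by (intro bij_betw_imageI inj_onI) (metis, simp)
    then have "bij_betw (\<lambda>a. fst (gid w) (dag w a)) (darcs w) (dag w ` darcs w)"
      by (rule bij_betw_cong[THEN iffD1, rotated])
        (use wd(4,7) in \<open>auto simp: gid_def gmap_of_def etale_id_def\<close>)
    then have bij: "bij_betw (\<lambda>a. fst (gid w) (dag w a)) (nb w v) (emb_boundary (snd (gid w) v))"
      unfolding idb is_star_nb[OF 2] is_star_boundary[OF 2] .
    \<comment> \<open>This matters for the star without arms: its boundary is empty, so some vertex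
      must go to a class that is not an edge. The class here has a vertex, while edges have
      none.\<close>
    have "\<not> emb_is_edge (snd (gid w) v)"
    proof
      assume "emb_is_edge (snd (gid w) v)"
      then obtain H h where H: "(H, h) \<in> emb_class w w (etale_id w)" "isomorphic H edge_graph"
        by (auto simp: emb_is_edge_def id)
      have "verts H = {}" using H(2) by (auto simp: isomorphic_def graph_iso_def edge_graph_def bij_betw_def)
      then show False using emb_class_member(1)[OF embedding_id[OF wc] H(1)] v by simp
    qed
    then show ?thesis
      using arcs ext emb bij
      by (auto simp: hom_U_def pre_graphical_def v id PiE_iff)
  qed
qed

lemma active_gid: "active w w (gid w)"
proof -
  have "boundary w \<subseteq> arcs w" by (auto simp: boundary_def)
  then have "bij_betw (restrict id (arcs w)) (boundary w) (boundary w)"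
    by (intro bij_betw_cong[THEN iffD1, rotated, OF bij_betw_id]) auto
  then show ?thesis by (simp add: active_def gid_def gmap_of_def etale_id_def)
qed

text \<open>An inert map is itself composed with the identity, which is active. Membership in
  \<open>cat_G\<close> thereby reduces to convexity of \<open>f\<close>.\<close>

lemma has_image_elementary:
  assumes c: "c \<in> conn_graphs" and w: "elementary w" and f: "embedding w c f"
  shows "has_image w c (gmap_of w c f) (emb_class c w f)"
  unfolding has_image_def
  using gid_hom_U[OF w] active_gid[of w] gcomp_gid[OF c w f] f is_tree_conn_graphs[OF elementary_is_tree[OF w]]
  by metis

section \<open>Convexity of elementary embeddings\<close>

lemma directed_path_Cons:
  "directed_path c (e # es) (v # vs) \<longleftrightarrow> e \<in> edges (fst c) \<and> v \<in> verts (fst c) \<and>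
     e \<inter> in_arcs c v \<noteq> {} \<and> hd es \<inter> out_arcs c v \<noteq> {} \<and> directed_path c es vs"
  by (cases es) (auto simp: directed_path_def All_less_Suc2)

lemma directed_path_snoc:
  assumes "es \<noteq> []"
  shows "directed_path c (es @ [e]) (vs @ [v]) \<longleftrightarrow> e \<in> edges (fst c) \<and> v \<in> verts (fst c) \<and>
     last es \<inter> in_arcs c v \<noteq> {} \<and> e \<inter> out_arcs c v \<noteq> {} \<and> directed_path c es vs"
proof (cases "length es = Suc (length vs)")
  case True
  then have "last es = es ! length vs" using assms by (simp add: last_conv_nth)
  then show ?thesis
    using True by (auto simp: directed_path_def All_less_Suc nth_append)
qed (simp add: directed_path_def)

lemma directed_path_nonempty: "directed_path c es vs \<Longrightarrow> es \<noteq> []"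
  by (auto simp: directed_path_def)

text \<open>Appending \<open>u\<close> and the first edge closes the path up.\<close>

lemma acyclic_no_return:
  assumes "acyclic_ograph c" and p: "directed_path c es vs"
    and u: "u \<in> verts (fst c)" "hd es \<inter> out_arcs c u \<noteq> {}" "last es \<inter> in_arcs c u \<noteq> {}"
  shows False
proof -
  have ne: "es \<noteq> []" using p by (rule directed_path_nonempty)
  then have "hd es \<in> edges (fst c)" using p by (auto simp: directed_path_def)
  then have "directed_path c (es @ [hd es]) (vs @ [u])"
    using p u by (simp add: directed_path_snoc[OF ne])
  moreover have "hd (es @ [hd es]) = last (es @ [hd es])" using ne by simp
  ultimately show False using assms(1) unfolding acyclic_ograph_def by blast
qed

text \<open>An edge has one arc of each sign, and an arc has only one target.\<close>

lemma edge_end_unique: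
  assumes G: "graph_data G" and x: "orientation G x" and e: "e \<in> edges G"
  shows "e \<inter> out_arcs (G, x) u \<noteq> {} \<Longrightarrow> e \<inter> out_arcs (G, x) v \<noteq> {} \<Longrightarrow> u = v"
    and "e \<inter> in_arcs (G, x) u \<noteq> {} \<Longrightarrow> e \<inter> in_arcs (G, x) v \<noteq> {} \<Longrightarrow> u = v"
proof -
  obtain a where a: "a \<in> arcs G" "e = {a, dag G a}" using e by (auto simp: edges_def edge_of_def)
  have "x (dag G a) = - x a" "x a \<noteq> - x a" using orientationD[OF x a(1)] by auto
  then have uniq: "b = d" if "b \<in> e" "d \<in> e" "x b = x d" for b d using that a(2) by auto
  show "e \<inter> out_arcs (G, x) u \<noteq> {} \<Longrightarrow> e \<inter> out_arcs (G, x) v \<noteq> {} \<Longrightarrow> u = v"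
    "e \<inter> in_arcs (G, x) u \<noteq> {} \<Longrightarrow> e \<inter> in_arcs (G, x) v \<noteq> {} \<Longrightarrow> u = v"
    using uniq by (force simp: out_arcs_def in_arcs_def nb_def)+
qed

text \<open>No path may leave \<open>u\<close> and come back. A path with vertices whose first edge
  leaves \<open>u\<close> would also end with an edge leaving \<open>u\<close>, and so reach
  \<open>u\<close> just before it. A path whose first edge enters \<open>u\<close> passes
  \<open>u\<close> at once, and the same argument forbids further vertices in its remainder.\<close>

lemma directed_path_at_vertex:
  assumes G: "graph_data G" and x: "orientation G x" and acyc: "acyclic_ograph (G, x)"
    and p: "directed_path (G, x) es vs" and u: "u \<in> verts G"
    and adj: "hd es \<inter> nb G u \<noteq> {}" "last es \<inter> nb G u \<noteq> {}"
  shows "set es \<subseteq> {hd es, last es} \<and> set vs \<subseteq> {u}"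
proof -
  let ?c = "(G, x)"
  have sign: "e \<inter> out_arcs ?c u \<noteq> {} \<or> e \<inter> in_arcs ?c u \<noteq> {}" if e: "e \<inter> nb G u \<noteq> {}" for e
  proof -
    obtain d where d: "d \<in> e" "d \<in> nb G u" using e by blast
    then have "x d = 1 \<or> x d = -1" using orientationD(1)[OF x] graph_dataD(7)[OF G] by (auto simp: nb_def)
    then show ?thesis using d by (auto simp: out_arcs_def in_arcs_def)
  qed
  have no_return: "\<not> (hd es' \<inter> out_arcs ?c u \<noteq> {} \<and> last es' \<inter> in_arcs ?c u \<noteq> {})"
    if "directed_path ?c es' vs'" for es' vs'
    using acyclic_no_return[OF acyc that, of u] u by auto
  have ne: "es \<noteq> []" using p by (rule directed_path_nonempty)
  \<comment> \<open>An edge leaves only one vertex, so the last vertex is \<open>u\<close>; cutting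
    it off gives a path ending with an edge into \<open>u\<close>. The claim is made for arbitrary
    lists since it serves both the path and its remainder.\<close>
  have last_out: "\<exists>es' vs'. es = es' @ [last es] \<and> vs = vs' @ [u] \<and> es' \<noteq> [] \<and>
      last es' \<inter> in_arcs ?c u \<noteq> {} \<and> directed_path ?c es' vs'"
    if p: "directed_path ?c es vs" and "vs \<noteq> []" and out: "last es \<inter> out_arcs ?c u \<noteq> {}" for es vs
  proof -
    obtain vs' v where vs: "vs = vs' @ [v]" using \<open>vs \<noteq> []\<close> by (metis rev_exhaust)
    have "length es = Suc (Suc (length vs'))" using p by (simp add: directed_path_def vs)
    then have "es = butlast es @ [last es]" "butlast es \<noteq> []"
      by (auto simp flip: length_0_conv intro!: append_butlast_last_id[symmetric])
    then obtain es' e where es: "es = es' @ [e]" "es' \<noteq> []" by blast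
    have *: "e \<in> edges G" "last es' \<inter> in_arcs ?c v \<noteq> {}" "e \<inter> out_arcs ?c v \<noteq> {}" "directed_path ?c es' vs'"
      using p directed_path_snoc[OF es(2), of ?c e vs' v] unfolding es(1) vs by auto
    then have "u = v" using edge_end_unique(1)[OF G x] out es(1) by simp
    then show ?thesis using * es vs by auto
  qed
  have first_in: "\<exists>es' vs'. es = hd es # es' \<and> vs = u # vs' \<and>
      hd es' \<inter> out_arcs ?c u \<noteq> {} \<and> directed_path ?c es' vs'"
    if ne: "vs \<noteq> []" and inn: "hd es \<inter> in_arcs ?c u \<noteq> {}"
  proof -
    obtain v vs' where vs: "vs = v # vs'" using ne by (cases vs) auto
    obtain e es' where es: "es = e # es'" using \<open>es \<noteq> []\<close> by (cases es) auto
    have *: "e \<in> edges G" "hd es' \<inter> out_arcs ?c v \<noteq> {}" "e \<inter> in_arcs ?c v \<noteq> {}" "directed_path ?c es' vs'"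
      using p unfolding es vs directed_path_Cons by auto
    then have "u = v" using edge_end_unique(2)[OF G x] inn es by simp
    then show ?thesis using * es vs by auto
  qed
  show ?thesis
  proof (cases "vs = []")
    case True
    then have "length es = 1" using p by (simp add: directed_path_def)
    then show ?thesis using True by (cases es) auto
  next
    case False
    show ?thesis
    proof (cases "hd es \<inter> out_arcs ?c u \<noteq> {}")
      case out: True
      then have "last es \<inter> out_arcs ?c u \<noteq> {}" using no_return[OF p] sign adj(2) by blast
      then obtain es' vs' where *: "es = es' @ [last es]" "es' \<noteq> []"
          "last es' \<inter> in_arcs ?c u \<noteq> {}" "directed_path ?c es' vs'"
        using last_out[OF p False] by blast
      have "hd es' = hd es" using *(1,2) by (metis hd_append)
      then show ?thesis using no_return[OF *(4)] *(3) out by simp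
    next
      case False
      then have "hd es \<inter> in_arcs ?c u \<noteq> {}" using sign adj(1) by blast
      then obtain es1 vs1 where 1: "es = hd es # es1" "vs = u # vs1"
          "hd es1 \<inter> out_arcs ?c u \<noteq> {}" "directed_path ?c es1 vs1"
        using first_in \<open>vs \<noteq> []\<close> by blast
      have ne1: "es1 \<noteq> []" using 1(4) by (rule directed_path_nonempty)
      then have last1: "last es1 = last es" using 1(1) by (metis last_ConsR)
      then have out: "last es1 \<inter> out_arcs ?c u \<noteq> {}" using no_return[OF 1(4)] 1(3) sign adj(2) by auto
      show ?thesis
      proof (cases "vs1 = []")
        case True
        then have "length es1 = 1" using 1(4) by (simp add: directed_path_def)
        then have "es1 = [last es1]" by (cases es1) auto
        then have "set es = {hd es, last es}" using 1(1) last1 by (metis list.set(1,2) list.simps(15))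
        then show ?thesis using 1(2) True by simp
      next
        case False
        then obtain es2 vs2 where *: "es1 = es2 @ [last es1]" "es2 \<noteq> []"
            "last es2 \<inter> in_arcs ?c u \<noteq> {}" "directed_path ?c es2 vs2"
          using last_out[OF 1(4) False out] by blast
        have "hd es2 = hd es1" using *(1,2) by (metis hd_append)
        then show ?thesis using no_return[OF *(4)] *(3) 1(3) by simp
      qed
    qed
  qed
qed

text \<open>For an edge, a path with equal first and last edge is trivial by acyclicity; for a star,
  \<open>directed_path_at_vertex\<close> applies at the image of the vertex. Injectivity on edges
  could only fail through a loop there, since both of its arcs would come from different
  arms.\<close>

lemma elementary_convex:
  assumes w: "elementary w" and f: "embedding w G f"
    and x: "orientation G x" and acyc: "acyclic_ograph (G, x)"
  shows "convex_inclusion w (G, x) f"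
proof -
  note G = embeddingD(2)[OF f]
  note wd = graph_dataD[OF embeddingD(1)[OF f]] and fd = etaleD[OF embeddingD(3)[OF f]]
    and Gd = graph_dataD[OF G]
  let ?I = "(\<lambda>e. fst f ` e) ` edges w"
  have img: "fst f ` edge_of w a = edge_of G (fst f a)" if "a \<in> arcs w" for a
    using that fd(5) by (simp add: edge_of_def)
  have "inj_on (\<lambda>e. fst f ` e) (edges w) \<and>
     (\<forall>es vs. directed_path (G, x) es vs \<and> hd es \<in> ?I \<and> last es \<in> ?I \<longrightarrow>
        set es \<subseteq> ?I \<and> set vs \<subseteq> snd f ` verts w)"
    using w
  proof (cases rule: elementary_cases)
    case 1
    then obtain a where a: "arcs w = {a, dag w a}" by (auto simp: is_edge_def)
    then have "edge_of w (dag w a) = edge_of w a" using wd(5)[of a] by (auto simp: edge_of_def)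
    then have E: "edges w = {edge_of w a}" using a by (auto simp: edges_def)
    show ?thesis
    proof (intro conjI allI impI)
      fix es vs assume p: "directed_path (G, x) es vs \<and> hd es \<in> ?I \<and> last es \<in> ?I"
      then have "hd es = last es" by (auto simp: E)
      then have vs: "vs = []" using p acyc by (auto simp: acyclic_ograph_def)
      then have "length es = 1" using p by (simp add: directed_path_def)
      then have "set es = {hd es}" by (cases es) auto
      then show "set es \<subseteq> ?I" "set vs \<subseteq> snd f ` verts w" using p vs by auto
    qed (simp add: E)
  next
    case (2 v)
    have v: "verts w = {v}" "arcs w = darcs w \<union> dag w ` darcs w" using 2 by (auto simp: is_star_def)
    define u where "u = snd f v"
    have u: "u \<in> verts G" using fd(4) v(1) by (simp add: u_def)
    have bij: "bij_betw (fst f) (darcs w) (nb G u)" unfolding u_def by (rule star_embedding_bij[OF 2 f])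
    have "edge_of w (dag w d) = edge_of w d" if "d \<in> darcs w" for d
      using that wd(5,7) by (auto simp: edge_of_def)
    then have E: "edges w = edge_of w ` darcs w" unfolding edges_def v(2) by force
    have nbu: "fst f d \<in> nb G u" if "d \<in> darcs w" for d using bij_betw_apply[OF bij that] .
    have adj: "e \<inter> nb G u \<noteq> {}" if e: "e \<in> ?I" for e
    proof -
      obtain d where d: "d \<in> darcs w" "e = edge_of G (fst f d)" using e img wd(7) unfolding E by blast
      then show ?thesis using nbu[OF d(1)] by (auto simp: edge_of_def)
    qed
    \<comment> \<open>A loop at \<open>u\<close> is a path without vertices that both leaves and
      enters \<open>u\<close>.\<close>
    have no_loop: "dag G b \<notin> nb G u" if b: "b \<in> nb G u" for b
    proof
      assume b': "dag G b \<in> nb G u"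
      have ba: "b \<in> arcs G" using b Gd(7) by (simp add: nb_def)
      have "edge_of G b \<inter> out_arcs (G, x) u \<noteq> {}" "edge_of G b \<inter> in_arcs (G, x) u \<noteq> {}"
        using orientationD[OF x ba] b b' by (auto simp: edge_of_def out_arcs_def in_arcs_def)
      moreover have "directed_path (G, x) [edge_of G b] []"
        using ba by (auto simp: directed_path_def edges_def)
      ultimately show False using acyclic_no_return[OF acyc, of "[edge_of G b]" "[]" u] u by simp
    qed
    have "inj_on (\<lambda>e. fst f ` e) (edges w)"
    proof (rule inj_onI)
      fix e e' assume "e \<in> edges w" "e' \<in> edges w" and eq: "fst f ` e = fst f ` e'"
      then obtain d d' where d: "d \<in> darcs w" "e = edge_of w d" and d': "d' \<in> darcs w" "e' = edge_of w d'"
        by (auto simp: E)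
      have "edge_of G (fst f d) = edge_of G (fst f d')" using eq d d' img wd(7) by simp
      then have "fst f d' = fst f d \<or> fst f d' = dag G (fst f d)" by (auto simp: edge_of_def)
      then have "fst f d' = fst f d" using no_loop[OF nbu[OF d(1)]] nbu[OF d'(1)] by auto
      then show "e = e'" using bij d d' by (auto simp: bij_betw_def inj_on_def)
    qed
    moreover have "set es \<subseteq> ?I \<and> set vs \<subseteq> snd f ` verts w"
      if p: "directed_path (G, x) es vs \<and> hd es \<in> ?I \<and> last es \<in> ?I" for es vs
    proof -
      have "set es \<subseteq> {hd es, last es} \<and> set vs \<subseteq> {u}"
        using directed_path_at_vertex[OF G x acyc _ u, of es vs] p adj[of "hd es"] adj[of "last es"]
        by simp
      then show ?thesis using p by (auto simp: v(1) u_def)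
    qed
    ultimately show ?thesis by blast
  qed
  then show ?thesis using f embeddingD(4)[OF f] unfolding convex_inclusion_def fst_conv by blast
qed

section \<open>Comparisons between the graph categories\<close>

lemma cat_U_simps [simp]:
  "Ob cat_U = conn_graphs" "Hom cat_U = hom_U" "Id cat_U = gid"
  "Comp cat_U = (\<lambda>G G' G''. gcomp G G'')" "und cat_U = id"
  by (simp_all add: cat_U_def)

lemma cat_Ut_simps [simp]:
  "Ob cat_Ut = conn_graphs \<union> nodeless_loops" "Hom cat_Ut = hom_Ut" "Id cat_Ut = gid"
  "Comp cat_Ut = (\<lambda>G G' G''. gcomp G G'')" "und cat_Ut = id"
  by (simp_all add: cat_Ut_def)

lemma over_o_simps [simp]:
  "Ob (over_o D) = {c. fst c \<in> Ob D \<and> orientation (fst c) (snd c)}"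
  "Hom (over_o D) = (\<lambda>c d. {\<phi> \<in> Hom D (fst c) (fst d). \<forall>a\<in>arcs (fst c). snd d (fst \<phi> a) = snd c a})"
  "Id (over_o D) = (\<lambda>c. Id D (fst c))"
  "Comp (over_o D) = (\<lambda>c d e. Comp D (fst c) (fst d) (fst e))"
  "und (over_o D) = fst"
  by (simp_all add: over_o_def)

lemma cat_G_simps [simp]:
  "Ob cat_G = {c \<in> Ob (over_o cat_U). acyclic_ograph c}"
  "Hom cat_G = (\<lambda>c d. {\<phi> \<in> Hom (over_o cat_U) c d.
     \<exists>k. has_image (fst c) (fst d) \<phi> k \<and> (\<exists>(H, h)\<in>k. convex_inclusion H d h)})"
  "Id cat_G = Id (over_o cat_U)" "Comp cat_G = Comp (over_o cat_U)" "und cat_G = fst"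
  unfolding cat_G_def by simp_all

lemma over_o_cat_U0: "over_o cat_U0 = full_subcat (over_o cat_U) (\<lambda>c. is_tree (fst c))"
  by (auto simp: over_o_def cat_U0_def full_subcat_def cat_U_def)

lemma elementary_conn_graphs: "elementary w \<Longrightarrow> w \<in> conn_graphs"
  by (intro is_tree_conn_graphs elementary_is_tree)

text \<open>The two conditions on maps out of graphs without boundary can differ only if the target
  is a nodeless loop.\<close>

lemma hom_Ut_conn_graphs: "G' \<in> conn_graphs \<Longrightarrow> hom_Ut G G' = hom_U G G'"
  using conn_graphs_not_nodeless_loop[of G'] by (auto simp: hom_Ut_def hom_U_def)

lemma cat_U_in_cat_Ut: "slice_comparison (\<lambda>c. c) cat_U cat_Ut"
  by (rule slice_comparisonI) (auto simp: hom_Ut_conn_graphs elementary_conn_graphs)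

lemma over_o_cat_U_in_cat_Ut: "slice_comparison (\<lambda>c. c) (over_o cat_U) (over_o cat_Ut)"
  by (rule slice_comparisonI) (auto simp: hom_Ut_conn_graphs elementary_conn_graphs)

lemma orientation_pullback:
  assumes "graph_data w" and "orientation c x" and "pre_graphical w c p"
  shows "orientation w (\<lambda>a\<in>arcs w. x (fst p a))"
proof -
  have "fst p a \<in> arcs c" "fst p (dag w a) = dag c (fst p a)" if "a \<in> arcs w" for a
    using assms(3) that by (auto simp: pre_graphical_def)
  then show ?thesis
    using orientationD[OF assms(2)] graph_dataD(4)[OF assms(1)] by (auto simp: orientation_def)
qed

lemma orientation_ext:
  assumes "orientation G x" "orientation G y" "\<And>a. a \<in> arcs G \<Longrightarrow> x a = y a"
  shows "x = y"
  using assms by (intro extensionalityI[where A = "arcs G"]) (auto simp: orientation_def PiE_def)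

lemma elementary_graph_data: "elementary w \<Longrightarrow> graph_data w"
  by (simp add: elementary_def)

text \<open>The orientation of \<open>w\<close> has to be the pullback of that of \<open>c\<close>
  along \<open>p\<close>, whence existence and uniqueness of lifts. A slice morphism respects
  orientations because those of its source and target are both pulled back from
  \<open>c\<close>.\<close>

lemma over_o_forget:
  assumes und: "und D = id" and hom: "\<And>G G' p. p \<in> Hom D G G' \<Longrightarrow> pre_graphical G G' p"
    and comp: "\<And>G G' G''. Comp D G G' G'' = gcomp G G''"
  shows "slice_comparison fst (over_o D) D"
proof (rule slice_comparisonI)
  fix c w p assume c: "c \<in> Ob (over_o D)" and w: "w \<in> Ob D" "elementary (und D w)"
    and p: "p \<in> Hom D w (fst c)"
  let ?y = "\<lambda>a\<in>arcs w. snd c (fst p a)"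
  have "graph_data w" "orientation (fst c) (snd c)"
    using elementary_graph_data w(2) c und by simp_all
  then have "orientation w ?y" using hom[OF p] by (rule orientation_pullback)
  then show "\<exists>w'\<in>Ob (over_o D). fst w' = w \<and> p \<in> Hom (over_o D) w' c"
    using w p by (intro bexI[of _ "(w, ?y)"]) auto
next
  fix c w w' p
  assume "w \<in> Ob (over_o D)" "w' \<in> Ob (over_o D)" "fst w = fst w'"
    "p \<in> Hom (over_o D) w c" "p \<in> Hom (over_o D) w' c"
  then show "w = w'" by (intro prod_eqI orientation_ext[of "fst w"]) auto
next
  fix c w w' p p' u
  assume p: "p \<in> Hom (over_o D) w c" and p': "p' \<in> Hom (over_o D) w' c"
    and u: "u \<in> Hom D (fst w) (fst w')" and eq: "Comp (over_o D) w w' c p' u = p"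
  have "snd w' (fst u a) = snd w a" if a: "a \<in> arcs (fst w)" for a
  proof -
    have "fst u a \<in> arcs (fst w')" using hom[OF u] a by (auto simp: pre_graphical_def)
    then have "snd w' (fst u a) = snd c (fst p' (fst u a))" using p' by simp
    also have "fst p' (fst u a) = fst p a"
      using a unfolding eq[symmetric] by (simp add: comp gcomp_def compose_def)
    also have "snd c (fst p a) = snd w a" using p a by simp
    finally show ?thesis .
  qed
  then show "u \<in> Hom (over_o D) w w'" using u by simp
qed (auto simp: und)

text \<open>No inert map from an elementary object to an acyclic one is lost in
  \<open>cat_G\<close>. The auxiliary fact \<open>hom\<close> handles structure maps and slice
  morphisms alike, both being of this kind.\<close>

lemma cat_G_in_over_o_cat_U: "slice_comparison (\<lambda>c. c) cat_G (over_o cat_U)"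
proof -
  have hom: "p \<in> Hom cat_G w c"
    if c: "c \<in> Ob cat_G" and w: "elementary (fst w)" and p: "p \<in> Hom (over_o cat_U) w c"
      and inert: "inert (fst w) (fst c) p" for c w p
  proof -
    obtain f where f: "embedding (fst w) (fst c) f" "p = gmap_of (fst w) (fst c) f"
      using inert by (auto simp: inert_def)
    have "has_image (fst w) (fst c) p (emb_class (fst c) (fst w) f)"
      unfolding f(2) using has_image_elementary[OF _ w f(1)] c by simp
    moreover have "convex_inclusion (fst w) c f"
      using elementary_convex[OF w f(1), of "snd c"] c by simp
    ultimately show ?thesis
      using p emb_class_self[OF f(1)] by auto
  qed
  show ?thesis
  proof (rule slice_comparisonI)
    fix c w p
    assume c: "c \<in> Ob cat_G" and w: "w \<in> Ob (over_o cat_U)" "elementary (und (over_o cat_U) w)"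
      and p: "p \<in> Hom (over_o cat_U) w c" "inert (und (over_o cat_U) w) (und cat_G c) p"
    have "p \<in> Hom cat_G w c" using hom[OF c _ p(1)] w(2) p(2) unfolding over_o_simps(5) cat_G_simps(5) .
    moreover have "acyclic_ograph w"
      using w tree_acyclic[OF elementary_is_tree, of "fst w" "snd w"] by simp
    then have "w \<in> Ob cat_G" using w(1) by simp
    ultimately show "\<exists>w'\<in>Ob cat_G. w' = w \<and> p \<in> Hom cat_G w' c" by blast
  next
    fix w w' u
    assume "w' \<in> Ob cat_G" "elementary (und cat_G w)" "u \<in> Hom (over_o cat_U) w w'"
      "inert (und cat_G w) (und cat_G w') u"
    then show "u \<in> Hom cat_G w w'" unfolding cat_G_simps(5) by (rule hom)
  qed auto
qed

lemma cat_U0_in_cat_U: "slice_comparison (\<lambda>c. c) cat_U0 cat_U"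
  unfolding cat_U0_def
  by (rule slice_comparison_full_subcat) (simp add: elementary_is_tree)

lemma over_o_cat_U0_in_over_o_cat_U: "slice_comparison (\<lambda>c. c) (over_o cat_U0) (over_o cat_U)"
  unfolding over_o_cat_U0
  by (rule slice_comparison_full_subcat) (simp add: elementary_is_tree)

text \<open>Only the star without arms has empty boundary. Its vertex would go to a vertex of
  \<open>c\<close> without incident arcs, which by connectedness is all of \<open>c\<close>.\<close>

lemma elementary_boundary_nonempty:
  assumes w: "elementary w" and f: "embedding w c f" and c: "c \<in> conn_graphs" "boundary c \<noteq> {}"
  shows "boundary w \<noteq> {}"
  using w
proof (cases rule: elementary_cases)
  case 1
  then show ?thesis by (auto simp: is_edge_def boundary_def)
next
  case (2 v)
  show ?thesis
  proof
    assume "boundary w = {}"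
    then have "darcs w = {}" using is_star_boundary[OF 2] by simp
    then have nb: "nb c (snd f v) = {}" using star_embedding_bij[OF 2 f] by (simp add: bij_betw_def)
    have "snd f v \<in> verts c" using etaleD(4)[OF embeddingD(3)[OF f]] 2 by (simp add: is_star_def)
    then have "subgraph_data c {} {snd f v}" "subgraph_data c (arcs c - {}) (verts c - {snd f v})"
      using nb graph_dataD(4,8)[OF embeddingD(2)[OF f]] by (auto simp: subgraph_data_def nb_def)
    then have "arcs c = {}" using connected_graph_split(1)[OF conn_graphsD(2)[OF c(1)]] by blast
    then show False using c(2) by (auto simp: boundary_def split: if_splits)
  qed
qed

lemma cat_Ucyc_in_cat_U0: "slice_comparison (\<lambda>c. c) cat_Ucyc cat_U0"
  unfolding cat_Ucyc_def
  by (rule slice_comparison_full_subcat)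
    (auto simp: cat_U0_def inert_def dest: elementary_boundary_nonempty is_tree_conn_graphs)

lemma cat_Gsc_in_cat_G: "slice_comparison (\<lambda>c. c) cat_Gsc cat_G"
  unfolding cat_Gsc_def
  by (rule slice_comparison_full_subcat) (simp add: elementary_is_tree)

text \<open>Passing through \<open>cat_G\<close> reuses the convexity argument; the composite takes
  values in trees and can be corestricted.\<close>

lemma cat_Gsc_in_over_o_cat_U0: "slice_comparison (\<lambda>c. c) cat_Gsc (over_o cat_U0)"
  unfolding over_o_cat_U0
  by (rule slice_comparison_factor[OF
        slice_comparison_comp[OF cat_Gsc_in_cat_G cat_G_in_over_o_cat_U]])
    (simp add: cat_Gsc_def)

lemma embedding_out_arcs:
  assumes f: "embedding w c f" and x: "\<And>a. a \<in> arcs w \<Longrightarrow> x (fst f a) = y a" and v: "v \<in> verts w"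
  shows "bij_betw (fst f) (out_arcs (w, y) v) (out_arcs (c, x) (snd f v))"
proof -
  have bij: "bij_betw (fst f) (nb w v) (nb c (snd f v))"
    using etaleD(8)[OF embeddingD(3)[OF f] v] .
  have y: "x (fst f d) = y d" if "d \<in> nb w v" for d
    using x graph_dataD(7)[OF embeddingD(1)[OF f]] that by (simp add: nb_def)
  have "fst f ` {d \<in> nb w v. y d = 1} = {b \<in> fst f ` nb w v. x b = 1}" using y by auto
  then show ?thesis
    using bij by (auto simp: bij_betw_def out_arcs_def inj_on_def)
qed

text \<open>An orientation-preserving embedding matches the outputs of a vertex with those of its
  image, so having a single output is inherited.\<close>

lemma cat_Omega_in_cat_Gsc: "slice_comparison (\<lambda>c. c) cat_Omega cat_Gsc"
  unfolding cat_Omega_def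
proof (rule slice_comparison_full_subcat, rule ballI)
  fix c w :: "('a, 'b) ograph" and p v
  assume c: "\<forall>v\<in>verts (fst c). is_singleton (out_arcs c v)" and p: "p \<in> Hom cat_Gsc w c"
    "inert (und cat_Gsc w) (und cat_Gsc c) p" and v: "v \<in> verts (fst w)"
  obtain f where f: "embedding (fst w) (fst c) f" "p = gmap_of (fst w) (fst c) f"
    using p(2) by (auto simp: inert_def cat_Gsc_def)
  have "bij_betw (fst f) (out_arcs w v) (out_arcs c (snd f v))"
    using embedding_out_arcs[OF f(1), of "snd c" "snd w" v] p(1) v
    by (simp add: cat_Gsc_def f(2) gmap_of_def)
  moreover have "is_singleton (out_arcs c (snd f v))"
    using c etaleD(4)[OF embeddingD(3)[OF f(1)] v] by blast
  ultimately show "is_singleton (out_arcs w v)"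
    using bij_betw_same_card by (fastforce simp: is_singleton_altdef)
qed

lemma forget_cat_U: "slice_comparison fst (over_o cat_U) cat_U"
  by (rule over_o_forget) (auto simp: hom_U_def)

lemma forget_cat_Ut: "slice_comparison fst (over_o cat_Ut) cat_Ut"
  by (rule over_o_forget) (auto simp: hom_Ut_def)

lemma forget_cat_U0: "slice_comparison fst (over_o cat_U0) cat_U0"
  by (rule over_o_forget) (auto simp: cat_U0_def hom_U_def)

lemma forget_cat_Gsc: "slice_comparison fst cat_Gsc cat_U0"
  using slice_comparison_comp[OF cat_Gsc_in_over_o_cat_U0 forget_cat_U0] .

lemma forget_cat_Omega: "slice_comparison fst cat_Omega cat_Ucyc"
  unfolding cat_Ucyc_def
proof (rule slice_comparison_factor)
  show "slice_comparison fst cat_Omega cat_U0"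
    using slice_comparison_comp[OF cat_Omega_in_cat_Gsc forget_cat_Gsc] .
  fix c :: "('a, 'b) ograph" assume "c \<in> Ob cat_Omega"
  then have "is_tree (fst c)" "orientation (fst c) (snd c)"
    "\<forall>v\<in>verts (fst c). is_singleton (out_arcs (fst c, snd c) v)"
    by (auto simp: cat_Omega_def cat_Gsc_def)
  then show "boundary (fst c) \<noteq> {}"
    by (intro boundary_nonempty) (auto simp: is_singleton_def)
qed

section \<open>Surjectivity on objects\<close>

lemma orientable: "graph_data G \<Longrightarrow> \<exists>x. orientation G x"
  using orientation_exists[of G "{}"] by blast

lemma surj_forget_cat_U: "G \<in> Ob cat_U \<Longrightarrow> \<exists>c\<in>Ob (over_o cat_U). fst c = G"
  using orientable[OF conn_graphsD(1)] by auto

lemma surj_forget_cat_Ut: "G \<in> Ob cat_Ut \<Longrightarrow> \<exists>c\<in>Ob (over_o cat_Ut). fst c = G"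
  using orientable[of G] by (auto simp: nodeless_loops_def is_nodeless_loop_def dest: conn_graphsD(1))

lemma surj_forget_cat_Gsc: "G \<in> Ob cat_U0 \<Longrightarrow> \<exists>c\<in>Ob cat_Gsc. fst c = G"
  using orientable[OF conn_graphsD(1), of G] tree_acyclic[of G]
  by (auto simp: cat_U0_def cat_Gsc_def)

lemma surj_forget_cat_Omega: "G \<in> Ob cat_Ucyc \<Longrightarrow> \<exists>c\<in>Ob cat_Omega. fst c = G"
  using rooted_orientation[of G] tree_acyclic[of G]
  by (auto simp: cat_Ucyc_def cat_U0_def cat_Gsc_def cat_Omega_def)

theorem proposition6p17:
  fixes M :: "(('a::infinite, 'v::infinite) graph, ('a, 'v) gmap, 'x) psh"
    and N :: "(('a, 'v) ograph, ('a, 'v) gmap, 'x) psh"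
  shows
   "((segal cat_Ucyc M \<longrightarrow> segal cat_Omega (pullback forget_o M)) \<and>
     (segal cat_Gsc N \<longrightarrow> segal cat_Omega (pullback incl N)) \<and>
     (segal cat_U0 M \<longrightarrow> segal cat_Ucyc (pullback incl M)) \<and>
     (segal (over_o cat_U0) N \<longrightarrow> segal cat_Gsc (pullback incl N)) \<and>
     (segal cat_U0 M \<longrightarrow> segal (over_o cat_U0) (pullback forget_o M)) \<and>
     (segal cat_G N \<longrightarrow> segal cat_Gsc (pullback incl N)) \<and>
     (segal (over_o cat_U) N \<longrightarrow> segal (over_o cat_U0) (pullback incl N)) \<and>
     (segal cat_U M \<longrightarrow> segal cat_U0 (pullback incl M)) \<and>
     (segal (over_o cat_U) N \<longrightarrow> segal cat_G (pullback incl N)) \<and>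
     (segal cat_U M \<longrightarrow> segal (over_o cat_U) (pullback forget_o M)) \<and>
     (segal (over_o cat_Ut) N \<longrightarrow> segal (over_o cat_U) (pullback incl N)) \<and>
     (segal cat_Ut M \<longrightarrow> segal cat_U (pullback incl M)) \<and>
     (segal cat_Ut M \<longrightarrow> segal (over_o cat_Ut) (pullback forget_o M)))
    \<and>
    ((presheaf cat_Ucyc M \<and> segal cat_Omega (pullback forget_o M) \<longrightarrow> segal cat_Ucyc M) \<and>
     (presheaf cat_U0 M \<and> segal cat_Gsc (pullback forget_o M) \<longrightarrow> segal cat_U0 M) \<and>
     (presheaf cat_U M \<and> segal (over_o cat_U) (pullback forget_o M) \<longrightarrow> segal cat_U M) \<and>
     (presheaf cat_Ut M \<and> segal (over_o cat_Ut) (pullback forget_o M) \<longrightarrow> segal cat_Ut M))"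
  using segal_pullback[OF _ incl_def] segal_pullback[OF _ forget_o_def]
    segal_reflect[OF forget_cat_Omega forget_o_def surj_forget_cat_Omega]
    segal_reflect[OF forget_cat_Gsc forget_o_def surj_forget_cat_Gsc]
    segal_reflect[OF forget_cat_U forget_o_def surj_forget_cat_U]
    segal_reflect[OF forget_cat_Ut forget_o_def surj_forget_cat_Ut]
    forget_cat_Omega cat_Omega_in_cat_Gsc cat_Ucyc_in_cat_U0 cat_Gsc_in_over_o_cat_U0 forget_cat_U0
    cat_Gsc_in_cat_G over_o_cat_U0_in_over_o_cat_U cat_U0_in_cat_U cat_G_in_over_o_cat_U forget_cat_U
    over_o_cat_U_in_cat_Ut cat_U_in_cat_Ut forget_cat_Ut
  by (intro conjI impI; (elim conjE)?; simp)

end
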